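(* Let $X$ be a finite-dimensional compact metric space, $Y\subseteq X$ compact, and $\mathcal U\subset C^0(X,X)$ a set of homeomorphisms that is uniformly h-expansive on $Y$. Let $f\in\mathcal U$ and $\mu$ an $f$-invariant Borel probability with $\operatorname{supp}\mu\subset Y$. Then for every $\varepsilon>0$ there are an open set $\mathcal V\ni f$ in $C^0(X,X)$ and an open set $U\ni\mu$ in $\mathcal P(Y)$ such that for every $g\in\mathcal U\cap\mathcal V$ and every $g$-invariant $\nu\in U\cap\mathcal P(Y)$, $$h_\nu(g)\le h_\mu(f)+\varepsilon.$$
   Context: Finite-dimensional means of finite covering (Lebesgue) dimension. $C^0(X,X)$ has the uniform topology; $\mathcal P(Y)$ is the space of Borel probabilities on $Y$ with the weak* topology; $h_\nu(g)$ is the Kolmogorov–Sinai metric entropy. For a homeomorphism $f$, $\varepsilon>0$ and $x\in X$, $\Gamma_\varepsilon(x,f)=\{y\in X: d(f^n(y),f^n(x))\le\varepsilon\ \forall n\in\mathbb Z\}$. For a compact $K\subset X$, $h_{top}(K,f)=\lim_{\delta\to0}\limsup_{n\to\infty}\frac1n\log r(K,n,\delta)$, where $r(K,n,\delta)$ is the minimal cardinality of a set $E\subset X$ such that every $y\in K$ has some $e\in E$ with $d(f^j(y),f^j(e))\le\delta$ for $0\le j<n$. A set $\mathcal U$ of homeomorphisms is uniformly h-expansive on $Y$ if there is $\varepsilon>0$ such that $h_{top}(\Gamma_\varepsilon(y,f),f)=0$ for all $f\in\mathcal U$ and all $y\in Y$. *)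

theory Defs
  imports "HOL-Probability.Probability"
begin

definition covering_dim_le :: "'a::metric_space set \<Rightarrow> nat \<Rightarrow> bool" where
  "covering_dim_le X n \<longleftrightarrow>
     (\<forall>C. finite C \<and> (\<forall>c\<in>C. openin (top_of_set X) c) \<and> X \<subseteq> \<Union>C \<longrightarrow>
        (\<exists>D. finite D \<and> (\<forall>d\<in>D. openin (top_of_set X) d) \<and> X \<subseteq> \<Union>D \<and>
             (\<forall>d\<in>D. \<exists>c\<in>C. d \<subseteq> c) \<and>
             (\<forall>x\<in>X. card {d\<in>D. x \<in> d} \<le> n + 1)))"

definition finite_covering_dim :: "'a::metric_space set \<Rightarrow> bool" where
  "finite_covering_dim X \<longleftrightarrow> (\<exists>n. covering_dim_le X n)"

definition C0 :: "'a::metric_space set \<Rightarrow> ('a \<Rightarrow> 'a) set" where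
  "C0 X = {g. continuous_on X g \<and> g ` X \<subseteq> X}"

definition unif_dist :: "'a::metric_space set \<Rightarrow> ('a \<Rightarrow> 'a) \<Rightarrow> ('a \<Rightarrow> 'a) \<Rightarrow> real" where
  "unif_dist X f g = (SUP x\<in>X. dist (f x) (g x))"

definition unif_open :: "'a::metric_space set \<Rightarrow> ('a \<Rightarrow> 'a) set \<Rightarrow> bool" where
  "unif_open X V \<longleftrightarrow> V \<subseteq> C0 X \<and>
     (\<forall>h\<in>V. \<exists>\<delta>>0. \<forall>g\<in>C0 X. unif_dist X h g < \<delta> \<longrightarrow> g \<in> V)"

definition homeos :: "'a::metric_space set \<Rightarrow> ('a \<Rightarrow> 'a) set" where
  "homeos X = {f. \<exists>g. homeomorphism X X f g}"

definition borel_prob :: "'a::metric_space set \<Rightarrow> 'a measure \<Rightarrow> bool" where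
  "borel_prob X M \<longleftrightarrow> space M = X \<and> sets M = sets (restrict_space borel X) \<and> prob_space M"

definition msupp :: "'a::metric_space set \<Rightarrow> 'a measure \<Rightarrow> 'a set" where
  "msupp X M = {x\<in>X. \<forall>r>0. emeasure M (ball x r \<inter> X) > 0}"

definition PY :: "'a::metric_space set \<Rightarrow> 'a set \<Rightarrow> 'a measure set" where
  "PY X Y = {M. borel_prob X M \<and> msupp X M \<subseteq> Y}"

definition intY :: "'a set \<Rightarrow> 'a measure \<Rightarrow> ('a \<Rightarrow> real) \<Rightarrow> real" where
  "intY Y M \<phi> = integral\<^sup>L M (\<lambda>x. indicator Y x * \<phi> x)"

text \<open>Open sets of the weak* topology on P(Y), i.e. the weakest topology making
all maps nu |-> integral phi dnu (phi continuous on Y) continuous.\<close>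
definition weak_star_open :: "'a::metric_space set \<Rightarrow> 'a set \<Rightarrow> 'a measure set \<Rightarrow> bool" where
  "weak_star_open X Y U \<longleftrightarrow> U \<subseteq> PY X Y \<and>
     (\<forall>\<mu>\<in>U. \<exists>\<Phi> \<eta>. finite \<Phi> \<and> (\<forall>\<phi>\<in>\<Phi>. continuous_on Y \<phi>) \<and> \<eta> > 0 \<and>
        {\<nu>\<in>PY X Y. \<forall>\<phi>\<in>\<Phi>. \<bar>intY Y \<nu> \<phi> - intY Y \<mu> \<phi>\<bar> < \<eta>} \<subseteq> U)"

definition invariant_measure :: "'a measure \<Rightarrow> ('a \<Rightarrow> 'a) \<Rightarrow> bool" where
  "invariant_measure M g \<longleftrightarrow> g \<in> measurable M M \<and> distr M M g = M"

definition part_entropy :: "'a measure \<Rightarrow> ('a \<Rightarrow> 'b) \<Rightarrow> real" where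
  "part_entropy M \<alpha> =
     - (\<Sum>v\<in>\<alpha> ` space M. measure M (\<alpha> -` {v} \<inter> space M) * ln (measure M (\<alpha> -` {v} \<inter> space M)))"

text \<open>Finite measurable partitions, encoded by finite-valued measurable labelings.\<close>
definition fin_partition :: "'a measure \<Rightarrow> ('a \<Rightarrow> nat) \<Rightarrow> bool" where
  "fin_partition M \<xi> \<longleftrightarrow> finite (\<xi> ` space M) \<and> \<xi> \<in> measurable M (count_space UNIV)"

text \<open>The join of xi, g^{-1} xi, ..., g^{-(n-1)} xi.\<close>
definition join_part :: "('a \<Rightarrow> 'a) \<Rightarrow> ('a \<Rightarrow> nat) \<Rightarrow> nat \<Rightarrow> 'a \<Rightarrow> nat list" where
  "join_part g \<xi> n = (\<lambda>x. map (\<lambda>i. \<xi> ((g ^^ i) x)) [0..<n])"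

definition ks_rate :: "'a measure \<Rightarrow> ('a \<Rightarrow> 'a) \<Rightarrow> ('a \<Rightarrow> nat) \<Rightarrow> real" where
  "ks_rate M g \<xi> = lim (\<lambda>n. part_entropy M (join_part g \<xi> (Suc n)) / real (Suc n))"

definition metric_entropy :: "'a measure \<Rightarrow> ('a \<Rightarrow> 'a) \<Rightarrow> ereal" where
  "metric_entropy M g = (SUP \<xi>\<in>{\<xi>. fin_partition M \<xi>}. ereal (ks_rate M g \<xi>))"

definition span_num :: "'a::metric_space set \<Rightarrow> ('a \<Rightarrow> 'a) \<Rightarrow> 'a set \<Rightarrow> nat \<Rightarrow> real \<Rightarrow> nat" where
  "span_num X f K n \<delta> = Inf {card E | E. finite E \<and> E \<subseteq> X \<and>
      (\<forall>y\<in>K. \<exists>e\<in>E. \<forall>j<n. dist ((f ^^ j) y) ((f ^^ j) e) \<le> \<delta>)}"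

definition htop :: "'a::metric_space set \<Rightarrow> ('a \<Rightarrow> 'a) \<Rightarrow> 'a set \<Rightarrow> ereal" where
  "htop X f K = Lim (at_right (0::real))
     (\<lambda>\<delta>. limsup (\<lambda>n. ereal (ln (real (span_num X f K n \<delta>)) / real n)))"

definition iter_int :: "'a set \<Rightarrow> ('a \<Rightarrow> 'a) \<Rightarrow> int \<Rightarrow> 'a \<Rightarrow> 'a" where
  "iter_int X f n = (if n \<ge> 0 then f ^^ nat n else (inv_into X f) ^^ nat (- n))"

definition Gamma :: "'a::metric_space set \<Rightarrow> real \<Rightarrow> 'a \<Rightarrow> ('a \<Rightarrow> 'a) \<Rightarrow> 'a set" where
  "Gamma X \<epsilon> x f = {y\<in>X. \<forall>n::int. dist (iter_int X f n y) (iter_int X f n x) \<le> \<epsilon>}"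

definition unif_h_expansive :: "'a::metric_space set \<Rightarrow> ('a \<Rightarrow> 'a) set \<Rightarrow> 'a set \<Rightarrow> bool" where
  "unif_h_expansive X \<U> Y \<longleftrightarrow>
     (\<exists>\<epsilon>>0. \<forall>f\<in>\<U>. \<forall>y\<in>Y. htop X f (Gamma X \<epsilon> y f) = 0)"

end

theory Submission
  imports Defs "HOL-Real_Asymp.Real_Asymp"
begin

text \<open>
  Let \<open>\<epsilon>\<close> be the common h-expansivity constant, and let \<open>\<xi>\<close> be a partition of \<open>X\<close> into pieces of
  diameter at most \<open>\<epsilon>\<close>, cut out by balls whose bounding spheres are \<open>\<mu>\<close>-null. If \<open>\<nu>\<close> is
  \<open>g\<close>-invariant and carried by \<open>Y\<close>, then \<open>\<xi>\<close> computes the entropy of \<open>(g, \<nu>)\<close>. Indeed, by compactness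
  the points following the orbit of \<open>x\<close> up to \<open>\<epsilon>\<close> during \<open>n + 2m\<close> steps are covered by
  \<open>exp (a (n + N))\<close> sets that are \<open>n\<close>-step small. Approximate any other partition \<open>\<eta>\<close> from inside by
  disjoint compact sets \<open>C\<^sub>i\<close>, and let \<open>b\<close> record the label of \<open>\<eta>\<close> only outside the union of the \<open>C\<^sub>i\<close>;
  then \<open>b\<close> has small entropy, and on each small set the \<open>b\<close>-name determines the \<open>\<eta>\<close>-name.
  Hence \<open>H(\<eta>\<^sup>n) \<le> H(\<xi>\<^bsup>n+2m+1\<^esup>) + n H(b) + a (n + N)\<close>; recording \<open>b\<close> avoids both the \<open>log 2\<close> of
  Bowen's counting argument and the passage to iterates. So the entropy is at most \<open>H(\<xi>\<^sup>n) / n\<close> for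
  each \<open>n\<close>, and for fixed \<open>n\<close> this quantity is continuous at \<open>(f, \<mu>)\<close> since the boundaries are null.
\<close>

section \<open>Entropy of finite partitions\<close>

text \<open>Comes from \<open>ln t \<le> t - 1\<close> at \<open>t = q i / p i\<close>, summed with
  weights \<open>p i\<close>. Asking only that \<open>q\<close> has no more total mass than
  \<open>p\<close> admits sub-probability vectors, as in \<open>part_entropy_le_count\<close>. The
  condition \<open>ac\<close> excludes terms whose true value is infinite, since \<open>ln 0\<close>
  is a real number in HOL.\<close>

lemma gibbs_inequality:
  fixes p q :: "'b \<Rightarrow> real"
  assumes "finite S" "\<And>i. i \<in> S \<Longrightarrow> 0 \<le> p i" "\<And>i. i \<in> S \<Longrightarrow> 0 \<le> q i"
    and ac: "\<And>i. i \<in> S \<Longrightarrow> q i = 0 \<Longrightarrow> p i = 0"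
    and sums: "(\<Sum>i\<in>S. q i) \<le> (\<Sum>i\<in>S. p i)"
  shows "- (\<Sum>i\<in>S. p i * ln (p i)) \<le> - (\<Sum>i\<in>S. p i * ln (q i))"
proof -
  have "p i * ln (q i) - p i * ln (p i) \<le> q i - p i" if i: "i \<in> S" for i
  proof (cases "p i = 0")
    case True
    then show ?thesis using assms(3)[OF i] by simp
  next
    case False
    then have p: "p i > 0" and q: "q i > 0"
      using assms(2,3)[OF i] ac[OF i] by (auto simp: less_le)
    then have "p i * (ln (q i) - ln (p i)) = p i * ln (q i / p i)"
      by (simp add: ln_div)
    also have "\<dots> \<le> p i * (q i / p i - 1)"
      using p q by (intro mult_left_mono ln_le_minus_one) auto
    also have "\<dots> = q i - p i"
      using p by (simp add: field_simps)
    finally show ?thesis by (simp add: algebra_simps)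
  qed
  then have "(\<Sum>i\<in>S. p i * ln (q i) - p i * ln (p i)) \<le> (\<Sum>i\<in>S. q i - p i)"
    by (rule sum_mono)
  then show ?thesis using sums by (simp add: sum_subtractf)
qed

abbreviation cell_prob :: "'a measure \<Rightarrow> ('a \<Rightarrow> 'b) \<Rightarrow> 'b \<Rightarrow> real" where
  "cell_prob M \<alpha> v \<equiv> measure M (\<alpha> -` {v} \<inter> space M)"

lemma cell_prob_eq_0: "v \<notin> \<alpha> ` space M \<Longrightarrow> cell_prob M \<alpha> v = 0"
proof -
  assume "v \<notin> \<alpha> ` space M"
  then have "\<alpha> -` {v} \<inter> space M = {}" by auto
  then show ?thesis by simp
qed

text \<open>Labels of empty cells contribute 0, so labelings with different ranges can be compared
  over one common label set.\<close>

lemma part_entropy_superset: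
  assumes "finite T" "\<alpha> ` space M \<subseteq> T"
  shows "part_entropy M \<alpha> = - (\<Sum>v\<in>T. cell_prob M \<alpha> v * ln (cell_prob M \<alpha> v))"
proof -
  have "(\<Sum>v\<in>\<alpha> ` space M. cell_prob M \<alpha> v * ln (cell_prob M \<alpha> v))
      = (\<Sum>v\<in>T. cell_prob M \<alpha> v * ln (cell_prob M \<alpha> v))"
    by (rule sum.mono_neutral_left) (use assms cell_prob_eq_0[of _ \<alpha> M] in auto)
  then show ?thesis by (simp add: part_entropy_def)
qed

context prob_space
begin

lemma cell_prob_fst:
  assumes a: "simple_function M \<alpha>" and b: "simple_function M \<beta>"
  shows "cell_prob M \<alpha> u = (\<Sum>v\<in>\<beta> ` space M. cell_prob M (\<lambda>x. (\<alpha> x, \<beta> x)) (u, v))"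
proof -
  have ab: "simple_function M (\<lambda>x. (\<alpha> x, \<beta> x))" by (rule simple_function_Pair[OF a b])
  have "\<alpha> -` {u} \<inter> space M
      = (\<Union>v\<in>\<beta> ` space M. (\<lambda>x. (\<alpha> x, \<beta> x)) -` {(u, v)} \<inter> space M)" by auto
  also have "measure M \<dots> = (\<Sum>v\<in>\<beta> ` space M. cell_prob M (\<lambda>x. (\<alpha> x, \<beta> x)) (u, v))"
    using b simple_functionD(2)[OF ab]
    by (intro finite_measure_finite_Union) (auto simp: simple_function_def disjoint_family_on_def)
  finally show ?thesis .
qed

lemma cell_prob_snd:
  assumes a: "simple_function M \<alpha>" and b: "simple_function M \<beta>"
  shows "cell_prob M \<beta> v = (\<Sum>u\<in>\<alpha> ` space M. cell_prob M (\<lambda>x. (\<alpha> x, \<beta> x)) (u, v))"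
proof -
  have "(\<lambda>x. (\<beta> x, \<alpha> x)) -` {(v, u)} = (\<lambda>x. (\<alpha> x, \<beta> x)) -` {(u, v)}" for u by auto
  then show ?thesis using cell_prob_fst[OF b a, of v] by simp
qed

lemma cell_prob_sum:
  assumes a: "simple_function M \<alpha>"
  shows "(\<Sum>u\<in>\<alpha> ` space M. cell_prob M \<alpha> u) = 1"
proof -
  have "space M = (\<Union>v\<in>\<alpha> ` space M. \<alpha> -` {v} \<inter> space M)" by auto
  then have "1 = measure M (\<Union>v\<in>\<alpha> ` space M. \<alpha> -` {v} \<inter> space M)"
    using prob_space by simp
  also have "\<dots> = (\<Sum>u\<in>\<alpha> ` space M. cell_prob M \<alpha> u)"
    using a by (intro finite_measure_finite_Union) (auto simp: simple_function_def disjoint_family_on_def)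
  finally show ?thesis by simp
qed

lemma cell_prob_pair_le:
  assumes a: "simple_function M \<alpha>" and b: "simple_function M \<beta>"
  shows "cell_prob M (\<lambda>x. (\<alpha> x, \<beta> x)) (u, v) \<le> cell_prob M \<alpha> u"
    and "cell_prob M (\<lambda>x. (\<alpha> x, \<beta> x)) (u, v) \<le> cell_prob M \<beta> v"
  using simple_functionD(2)[OF a] simple_functionD(2)[OF b]
  by (intro finite_measure_mono; auto)+

text \<open>Puts the joint and both marginal entropies over the same product index set with the same
  weights \<open>r\<close>, so that later comparisons become termwise or follow from
  \<open>gibbs_inequality\<close>.\<close>

lemma part_entropy_pair_cross:
  assumes a: "simple_function M \<alpha>" and b: "simple_function M \<beta>"
  defines "r \<equiv> cell_prob M (\<lambda>x. (\<alpha> x, \<beta> x))"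
  shows "part_entropy M (\<lambda>x. (\<alpha> x, \<beta> x))
           = - (\<Sum>p\<in>\<alpha> ` space M \<times> \<beta> ` space M. r p * ln (r p))"
    and "part_entropy M \<alpha> = - (\<Sum>p\<in>\<alpha> ` space M \<times> \<beta> ` space M. r p * ln (cell_prob M \<alpha> (fst p)))"
    and "part_entropy M \<beta> = - (\<Sum>p\<in>\<alpha> ` space M \<times> \<beta> ` space M. r p * ln (cell_prob M \<beta> (snd p)))"
    and "(\<Sum>p\<in>\<alpha> ` space M \<times> \<beta> ` space M. r p) = 1"
proof -
  have fin: "finite (\<alpha> ` space M)" "finite (\<beta> ` space M)"
    using a b by (auto simp: simple_function_def)
  show "part_entropy M (\<lambda>x. (\<alpha> x, \<beta> x))
           = - (\<Sum>p\<in>\<alpha> ` space M \<times> \<beta> ` space M. r p * ln (r p))"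
    unfolding r_def by (rule part_entropy_superset) (use fin in auto)
  show "part_entropy M \<alpha> = - (\<Sum>p\<in>\<alpha> ` space M \<times> \<beta> ` space M. r p * ln (cell_prob M \<alpha> (fst p)))"
    unfolding part_entropy_def sum.cartesian_product'
    by (simp add: r_def sum_distrib_right[symmetric] cell_prob_fst[OF a b, symmetric])
  show "part_entropy M \<beta> = - (\<Sum>p\<in>\<alpha> ` space M \<times> \<beta> ` space M. r p * ln (cell_prob M \<beta> (snd p)))"
    unfolding part_entropy_def sum.cartesian_product'
    by (subst sum.swap) (simp add: r_def sum_distrib_right[symmetric] cell_prob_snd[OF a b, symmetric])
  show "(\<Sum>p\<in>\<alpha> ` space M \<times> \<beta> ` space M. r p) = 1"
    unfolding sum.cartesian_product'
    by (simp add: r_def cell_prob_fst[OF a b, symmetric] cell_prob_sum[OF a])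
qed

text \<open>Nonnegativity of mutual information: the joint law is compared with the product of its
  marginals.\<close>

lemma part_entropy_pair_le:
  assumes a: "simple_function M \<alpha>" and b: "simple_function M \<beta>"
  shows "part_entropy M (\<lambda>x. (\<alpha> x, \<beta> x)) \<le> part_entropy M \<alpha> + part_entropy M \<beta>"
proof -
  let ?S = "\<alpha> ` space M \<times> \<beta> ` space M"
  let ?r = "cell_prob M (\<lambda>x. (\<alpha> x, \<beta> x))"
  let ?p = "cell_prob M \<alpha>" and ?q = "cell_prob M \<beta>"
  note cross = part_entropy_pair_cross[OF a b]
  have fin: "finite (\<alpha> ` space M)" "finite (\<beta> ` space M)"
    using a b by (auto simp: simple_function_def)
  have le: "?r s \<le> ?p (fst s)" "?r s \<le> ?q (snd s)" for s
    using cell_prob_pair_le[OF a b, of "fst s" "snd s"] by simp_all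
  have zero: "?r s = 0" if "?p (fst s) = 0 \<or> ?q (snd s) = 0" for s
    using that le[of s] measure_nonneg[of M] by (metis order_antisym)
  have "- (\<Sum>s\<in>?S. ?r s * ln (?r s)) \<le> - (\<Sum>s\<in>?S. ?r s * ln (?p (fst s) * ?q (snd s)))"
  proof (rule gibbs_inequality)
    have "(\<Sum>s\<in>?S. ?p (fst s) * ?q (snd s)) = 1"
      unfolding sum.cartesian_product'
      by (simp add: sum_distrib_left[symmetric] cell_prob_sum[OF a] cell_prob_sum[OF b])
    then show "(\<Sum>s\<in>?S. ?p (fst s) * ?q (snd s)) \<le> (\<Sum>s\<in>?S. ?r s)"
      using cross(4) by simp
  qed (use fin zero in auto)
  also have "(\<Sum>s\<in>?S. ?r s * ln (?p (fst s) * ?q (snd s)))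
      = (\<Sum>s\<in>?S. ?r s * ln (?p (fst s)) + ?r s * ln (?q (snd s)))"
  proof (rule sum.cong[OF refl])
    fix s
    show "?r s * ln (?p (fst s) * ?q (snd s)) = ?r s * ln (?p (fst s)) + ?r s * ln (?q (snd s))"
      using zero[of s] by (cases "?r s = 0") (auto simp: ln_mult zero_less_measure_iff algebra_simps)
  qed
  finally show ?thesis using cross by (simp add: sum.distrib)
qed

text \<open>The conditional entropy of \<open>\<beta>\<close> given \<open>\<alpha>\<close> is at
  most the logarithm of the number of \<open>\<beta>\<close>-labels met inside one
  \<open>\<alpha>\<close>-cell. Labels are counted only on the full-measure set \<open>G\<close>,
  since a pair of labels not met there has mass 0.\<close>

lemma part_entropy_le_count:
  assumes a: "simple_function M \<alpha>" and b: "simple_function M \<beta>"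
    and G: "AE x in M. x \<in> G"
    and count: "\<And>u. finite (\<beta> ` {x \<in> space M \<inter> G. \<alpha> x = u})"
      "\<And>u. real (card (\<beta> ` {x \<in> space M \<inter> G. \<alpha> x = u})) \<le> K"
    and K: "K > 0"
  shows "part_entropy M \<beta> \<le> part_entropy M \<alpha> + ln K"
proof -
  let ?A = "\<alpha> ` space M" and ?B = "\<beta> ` space M"
  let ?r = "cell_prob M (\<lambda>x. (\<alpha> x, \<beta> x))"
  let ?p = "cell_prob M \<alpha>" and ?q = "cell_prob M \<beta>"
  define R where "R u = \<beta> ` {x \<in> space M \<inter> G. \<alpha> x = u}" for u
  note cross = part_entropy_pair_cross[OF a b]
  have fin: "finite ?A" "finite ?B"
    using a b by (auto simp: simple_function_def)
  have le: "?r s \<le> ?p (fst s)" "?r s \<le> ?q (snd s)" for s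
    using cell_prob_pair_le[OF a b, of "fst s" "snd s"] by simp_all
  have null: "?r (u, v) = 0" if "v \<notin> R u" for u v
  proof -
    have "AE x in M. x \<notin> (\<lambda>x. (\<alpha> x, \<beta> x)) -` {(u, v)} \<inter> space M"
      using G by eventually_elim (use that in \<open>auto simp: R_def\<close>)
    then show ?thesis
      using simple_functionD(2)[OF simple_function_Pair[OF a b]]
      by (subst prob_eq_0) auto
  qed
  have "part_entropy M \<beta> \<le> part_entropy M (\<lambda>x. (\<alpha> x, \<beta> x))"
  proof -
    have "?r s * ln (?r s) \<le> ?r s * ln (?q (snd s))" for s
    proof (cases "?r s = 0")
      case False
      then have "0 < ?r s" by (simp add: zero_less_measure_iff)
      then show ?thesis using le(2)[of s] by (intro mult_left_mono) auto
    qed simp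
    then have "(\<Sum>s\<in>?A \<times> ?B. ?r s * ln (?r s)) \<le> (\<Sum>s\<in>?A \<times> ?B. ?r s * ln (?q (snd s)))"
      by (intro sum_mono)
    then show ?thesis using cross by simp
  qed
  \<comment> \<open>The comparison vector gives \<open>1 / K\<close> of the mass of an
    \<open>\<alpha>\<close>-cell to each pair of positive mass over it. At most \<open>K\<close>
    labels occur per cell, so the total is at most 1.\<close>
  also have "\<dots> \<le> - (\<Sum>s\<in>?A \<times> ?B. ?r s * ln (if ?r s = 0 then 0 else ?p (fst s) / K))"
    unfolding cross(1)
  proof (rule gibbs_inequality)
    fix s assume "(if ?r s = 0 then 0 else ?p (fst s) / K) = 0"
    then show "?r s = 0"
      using K le(1)[of s] measure_nonneg[of M] by (auto split: if_splits intro: order_antisym)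
  next
    have "(\<Sum>s\<in>?A \<times> ?B. if ?r s = 0 then 0 else ?p (fst s) / K)
        = (\<Sum>u\<in>?A. \<Sum>v\<in>?B. if ?r (u, v) = 0 then 0 else ?p u / K)"
      unfolding sum.cartesian_product' fst_conv ..
    also have "\<dots> \<le> (\<Sum>u\<in>?A. ?p u)"
    proof (rule sum_mono)
      fix u
      have "(\<Sum>v\<in>?B. if ?r (u, v) = 0 then 0 else ?p u / K)
          \<le> (\<Sum>v\<in>?B. if v \<in> R u then ?p u / K else 0)"
        using K null by (intro sum_mono) auto
      also have "\<dots> = real (card (?B \<inter> R u)) * (?p u / K)"
        using fin by (simp add: sum.If_cases Int_def)
      also have "\<dots> \<le> K * (?p u / K)"
      proof (rule mult_right_mono)
        have "card (?B \<inter> R u) \<le> card (R u)"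
          using count(1)[of u] by (intro card_mono) (auto simp: R_def)
        then show "real (card (?B \<inter> R u)) \<le> K" using count(2)[of u] by (simp add: R_def)
      qed (use K in auto)
      finally show "(\<Sum>v\<in>?B. if ?r (u, v) = 0 then 0 else ?p u / K) \<le> ?p u" using K by simp
    qed
    finally show "(\<Sum>s\<in>?A \<times> ?B. if ?r s = 0 then 0 else ?p (fst s) / K) \<le> (\<Sum>s\<in>?A \<times> ?B. ?r s)"
      using cross(4) cell_prob_sum[OF a] by simp
  qed (use fin K in auto)
  also have "(\<Sum>s\<in>?A \<times> ?B. ?r s * ln (if ?r s = 0 then 0 else ?p (fst s) / K))
      = (\<Sum>s\<in>?A \<times> ?B. ?r s * ln (?p (fst s)) - ?r s * ln K)"
  proof (rule sum.cong[OF refl])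
    fix s
    have "?p (fst s) > 0" if "?r s \<noteq> 0"
      using that le(1)[of s] zero_less_measure_iff[of M] by (metis order_less_le_trans)
    then show "?r s * ln (if ?r s = 0 then 0 else ?p (fst s) / K)
        = ?r s * ln (?p (fst s)) - ?r s * ln K"
      using K by (auto simp: ln_div algebra_simps)
  qed
  also have "- \<dots> = part_entropy M \<alpha> + ln K"
    using cross by (simp add: sum_subtractf sum_distrib_right[symmetric])
  finally show ?thesis .
qed

text \<open>The counting bound with \<open>K = 1\<close>: each \<open>\<alpha>\<close>-cell meets a
  single \<open>\<beta>\<close>-label.\<close>

lemma part_entropy_factor_le:
  assumes a: "simple_function M \<alpha>" and b: "simple_function M \<beta>"
    and "\<And>x. x \<in> space M \<Longrightarrow> \<beta> x = \<phi> (\<alpha> x)"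
  shows "part_entropy M \<beta> \<le> part_entropy M \<alpha>"
proof -
  have sub: "\<beta> ` {x \<in> space M \<inter> UNIV. \<alpha> x = u} \<subseteq> {\<phi> u}" for u
    using assms(3) by auto
  have fin: "finite (\<beta> ` {x \<in> space M \<inter> UNIV. \<alpha> x = u})" for u
    using finite_subset[OF sub] by blast
  have "card (\<beta> ` {x \<in> space M \<inter> UNIV. \<alpha> x = u}) \<le> 1" for u
    using card_mono[OF _ sub[of u]] by simp
  then have "part_entropy M \<beta> \<le> part_entropy M \<alpha> + ln 1"
    by (intro part_entropy_le_count[OF a b, where G = UNIV]) (use fin in auto)
  then show ?thesis by simp
qed

lemma part_entropy_nonneg:
  shows "part_entropy M \<alpha> \<ge> 0"
proof -
  have "p * ln p \<le> 0" if "0 \<le> p" "p \<le> 1" for p :: real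
    using that by (cases "p = 0") (auto intro!: mult_nonneg_nonpos)
  then show ?thesis
    unfolding part_entropy_def using prob_le_1 measure_nonneg by (auto intro!: sum_nonpos)
qed

end

lemma part_entropy_comp_distr:
  assumes T: "T \<in> measurable M M" and d: "distr M M T = M" and a: "simple_function M \<alpha>"
  shows "simple_function M (\<lambda>x. \<alpha> (T x))"
    and "part_entropy M (\<lambda>x. \<alpha> (T x)) = part_entropy M \<alpha>"
proof -
  have T': "T x \<in> space M" if "x \<in> space M" for x using measurable_space[OF T that] .
  show "simple_function M (\<lambda>x. \<alpha> (T x))"
    by (rule simple_function_comp[OF T a])
  have fin: "finite (\<alpha> ` space M)" using a by (auto simp: simple_function_def)
  have "cell_prob M (\<lambda>x. \<alpha> (T x)) v = cell_prob M \<alpha> v" for v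
  proof -
    have "cell_prob M \<alpha> v = measure (distr M M T) (\<alpha> -` {v} \<inter> space M)" by (simp add: d)
    also have "\<dots> = measure M (T -` (\<alpha> -` {v} \<inter> space M) \<inter> space M)"
      by (rule measure_distr[OF T simple_functionD(2)[OF a]])
    also have "T -` (\<alpha> -` {v} \<inter> space M) \<inter> space M = (\<lambda>x. \<alpha> (T x)) -` {v} \<inter> space M"
      using T' by auto
    finally show ?thesis by simp
  qed
  \<comment> \<open>The composed labeling may miss labels of \<open>\<alpha>\<close>, so both
    entropies are summed over the range of \<open>\<alpha>\<close>.\<close>
  then show "part_entropy M (\<lambda>x. \<alpha> (T x)) = part_entropy M \<alpha>"
    using part_entropy_superset[OF fin, of "\<lambda>x. \<alpha> (T x)" M] part_entropy_superset[OF fin, of \<alpha> M] T'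
    by auto
qed

section \<open>Subadditivity and the entropy rate of a partition\<close>

lemma subadditive_mult_le:
  fixes a :: "nat \<Rightarrow> real"
  assumes sub: "\<And>m n. a (m + n) \<le> a m + a n"
  shows "a (q * m + r) \<le> real q * a m + a r"
proof (induction q)
  case (Suc q)
  have "a (Suc q * m + r) = a (m + (q * m + r))" by (simp add: algebra_simps)
  also have "\<dots> \<le> a m + a (q * m + r)" by (rule sub)
  finally show ?case using Suc by (simp add: algebra_simps)
qed simp

text \<open>Division of the index by a well-chosen \<open>m\<close> with remainder shows that the
  quotients converge to their infimum. The second claim records that the limit lies below every
  quotient. Indices are shifted by \<open>Suc\<close> as in \<open>ks_rate\<close>.\<close>

lemma fekete:
  fixes a :: "nat \<Rightarrow> real"
  assumes sub: "\<And>m n. a (m + n) \<le> a m + a n" and nonneg: "\<And>n. 0 \<le> a n"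
  shows "convergent (\<lambda>n. a (Suc n) / real (Suc n))"
    and "lim (\<lambda>n. a (Suc n) / real (Suc n)) \<le> a (Suc k) / real (Suc k)"
proof -
  define u where "u n = a (Suc n) / real (Suc n)" for n
  define L where "L = (INF n. u n)"
  have bdd: "bdd_below (range u)"
    by (rule bdd_belowI[of _ 0]) (auto simp: u_def nonneg)
  have low: "L \<le> u n" for n unfolding L_def by (rule cINF_lower[OF bdd]) simp
  have "u \<longlonglongrightarrow> L"
  proof (rule LIMSEQ_I)
    fix e :: real assume e: "e > 0"
    obtain k where k: "u k < L + e / 2"
      using cINF_less_iff[OF _ bdd, of "L + e / 2"] e unfolding L_def by auto
    define m where "m = Suc k"
    \<comment> \<open>One bound for all possible remainder terms \<open>a r\<close>; it disappears
      after division by \<open>Suc n\<close>.\<close>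
    define C where "C = (\<Sum>r<m. a r)"
    have C: "a r \<le> C" if "r < m" for r
      unfolding C_def using that nonneg by (intro member_le_sum) auto
    obtain N :: nat where N: "C / (e / 2) < real N" using reals_Archimedean2 by blast
    show "\<exists>no. \<forall>n\<ge>no. norm (u n - L) < e"
    proof (intro exI allI impI)
      fix n assume n: "N \<le> n"
      define q r where "q = Suc n div m" and "r = Suc n mod m"
      have qr: "Suc n = q * m + r" by (simp add: q_def r_def)
      have r: "r < m" by (simp add: r_def m_def)
      have "a (Suc n) \<le> real q * a m + a r" unfolding qr by (rule subadditive_mult_le[OF sub])
      also have "real q * a m = real (q * m) * u k" by (simp add: u_def m_def field_simps)
      also have "\<dots> \<le> real (Suc n) * u k"
        unfolding qr by (intro mult_right_mono) (auto simp: u_def nonneg)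
      finally have "a (Suc n) \<le> real (Suc n) * u k + C" using C[OF r] by simp
      then have "u n \<le> (real (Suc n) * u k + C) / real (Suc n)"
        unfolding u_def[of n] by (intro divide_right_mono) auto
      also have "\<dots> = u k + C / real (Suc n)" by (simp add: add_divide_distrib)
      also have "C / real (Suc n) < e / 2"
      proof -
        have "C < real N * (e / 2)" using N e by (simp add: field_simps)
        also have "\<dots> \<le> real (Suc n) * (e / 2)" using n e by (intro mult_right_mono) auto
        finally show ?thesis by (simp add: field_simps)
      qed
      finally show "norm (u n - L) < e" using k low[of n] by simp
    qed
  qed
  then show "convergent (\<lambda>n. a (Suc n) / real (Suc n))"
    and "lim (\<lambda>n. a (Suc n) / real (Suc n)) \<le> a (Suc k) / real (Suc k)"
    using low[of k] limI[of u L] unfolding u_def convergent_def by auto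
qed

lemma invariant_measure_funpow:
  assumes "invariant_measure M g"
  shows "g ^^ n \<in> measurable M M" "distr M M (g ^^ n) = M"
proof -
  have g: "g \<in> measurable M M" and d: "distr M M g = M"
    using assms by (auto simp: invariant_measure_def)
  have "g ^^ n \<in> measurable M M \<and> distr M M (g ^^ n) = M"
  proof (induction n)
    case (Suc n)
    then have n: "g ^^ n \<in> measurable M M" and dn: "distr M M (g ^^ n) = M" by auto
    have "distr M M (g \<circ> (g ^^ n)) = distr (distr M M (g ^^ n)) M g"
      by (rule distr_distr[symmetric, OF g n])
    then show ?case using dn d measurable_comp[OF n g] by (simp add: comp_def)
  qed (simp add: id_def)
  then show "g ^^ n \<in> measurable M M" "distr M M (g ^^ n) = M" by auto
qed

lemma join_part_add: "join_part g \<xi> (m + n) x = join_part g \<xi> m x @ join_part g \<xi> n ((g ^^ m) x)"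
proof -
  have "[0..<m + n] = [0..<m] @ map (\<lambda>i. i + m) [0..<n]"
    using map_add_upt[of m n] upt_add_eq_append[of 0 m n] by (simp add: add.commute)
  then show ?thesis by (simp add: join_part_def funpow_add)
qed

lemma join_part_eq_iff:
  "join_part g \<xi> n x = join_part g \<xi> n y \<longleftrightarrow> (\<forall>i<n. \<xi> ((g ^^ i) x) = \<xi> ((g ^^ i) y))"
  by (auto simp: join_part_def)

lemma fin_partition_iff_simple: "fin_partition M \<xi> \<longleftrightarrow> simple_function M \<xi>"
proof
  assume "fin_partition M \<xi>"
  then show "simple_function M \<xi>"
    using measurable_sets[of \<xi> M "count_space UNIV"] by (auto simp: fin_partition_def simple_function_def)
next
  assume s: "simple_function M \<xi>"
  then show "fin_partition M \<xi>"
    using measurable_simple_function[OF s] simple_functionD(1)[OF s] by (simp add: fin_partition_def)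
qed

context prob_space
begin

lemma simple_function_join_part:
  assumes inv: "invariant_measure M g" and x: "simple_function M \<xi>"
  shows "simple_function M (join_part g \<xi> n)"
proof (induction n)
  case 0
  then show ?case by (simp add: join_part_def)
next
  case (Suc n)
  have "simple_function M (\<lambda>x. \<xi> ((g ^^ n) x))"
    by (rule part_entropy_comp_distr(1)[OF invariant_measure_funpow[OF inv] x])
  then have "simple_function M (\<lambda>x. join_part g \<xi> n x @ [\<xi> ((g ^^ n) x)])"
    using Suc by (intro simple_function_compose2[where h = "\<lambda>u v. u @ [v]"])
  then show ?case by (simp add: join_part_def)
qed

text \<open>A name of length \<open>m + n\<close> is a name of length \<open>m\<close> followed by
  the name of length \<open>n\<close> of the \<open>m\<close>-th iterate, and invariance gives the
  shifted block the entropy of the unshifted one.\<close>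

lemma part_entropy_join_subadd:
  assumes inv: "invariant_measure M g" and x: "simple_function M \<xi>"
  shows "part_entropy M (join_part g \<xi> (m + n))
           \<le> part_entropy M (join_part g \<xi> m) + part_entropy M (join_part g \<xi> n)"
proof -
  note s = simple_function_join_part[OF inv x]
  note c = part_entropy_comp_distr[OF invariant_measure_funpow[OF inv, of m] s[of n]]
  have "part_entropy M (join_part g \<xi> (m + n))
      \<le> part_entropy M (\<lambda>x. (join_part g \<xi> m x, join_part g \<xi> n ((g ^^ m) x)))"
    by (rule part_entropy_factor_le[where \<phi> = "\<lambda>(u, v). u @ v"])
      (use s c(1) in \<open>auto simp: join_part_add\<close>)
  also have "\<dots> \<le> part_entropy M (join_part g \<xi> m) + part_entropy M (\<lambda>x. join_part g \<xi> n ((g ^^ m) x))"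
    by (rule part_entropy_pair_le[OF s c(1)])
  finally show ?thesis using c(2) by simp
qed

lemma part_entropy_join_le:
  assumes inv: "invariant_measure M g" and x: "simple_function M \<xi>"
  shows "part_entropy M (join_part g \<xi> n) \<le> real n * part_entropy M \<xi>"
proof -
  \<comment> \<open>The empty join has the single label \<open>[]\<close>, of mass 1. This value is
    the remainder term when \<open>subadditive_mult_le\<close> is applied with \<open>m = 1\<close>
    and \<open>r = 0\<close>.\<close>
  have 0: "part_entropy M (join_part g \<xi> 0) = 0"
    using not_empty prob_space by (simp add: part_entropy_def join_part_def image_constant_conv vimage_def)
  have "part_entropy M (join_part g \<xi> 1) \<le> part_entropy M \<xi>"
    by (rule part_entropy_factor_le[OF x simple_function_join_part[OF inv x], where \<phi> = "\<lambda>v. [v]"])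
      (simp add: join_part_def)
  then have "real n * part_entropy M (join_part g \<xi> 1) \<le> real n * part_entropy M \<xi>"
    by (intro mult_left_mono) auto
  then show ?thesis
    using subadditive_mult_le[where a = "\<lambda>n. part_entropy M (join_part g \<xi> n)" and q = n and m = 1 and r = 0]
      part_entropy_join_subadd[OF inv x] 0 by simp
qed

text \<open>Makes the \<open>lim\<close> in \<open>ks_rate\<close> a genuine limit and an infimum.
  The limit serves to compare partitions; the infimum bounds the rate by the entropy at one fixed
  length, which is where upper semicontinuity comes from.\<close>

lemma ks_rate_tendsto:
  assumes inv: "invariant_measure M g" and x: "simple_function M \<xi>"
  shows "(\<lambda>n. part_entropy M (join_part g \<xi> (Suc n)) / real (Suc n)) \<longlonglongrightarrow> ks_rate M g \<xi>"
    and "ks_rate M g \<xi> \<le> part_entropy M (join_part g \<xi> (Suc n)) / real (Suc n)"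
proof -
  note f = fekete[where a = "\<lambda>n. part_entropy M (join_part g \<xi> n)",
      OF part_entropy_join_subadd[OF inv x] part_entropy_nonneg]
  show "(\<lambda>n. part_entropy M (join_part g \<xi> (Suc n)) / real (Suc n)) \<longlonglongrightarrow> ks_rate M g \<xi>"
    unfolding ks_rate_def using f(1) by (simp only: convergent_LIMSEQ_iff)
  show "ks_rate M g \<xi> \<le> part_entropy M (join_part g \<xi> (Suc n)) / real (Suc n)"
    unfolding ks_rate_def by (rule f(2))
qed

end

text \<open>The only delicate point is 0, where the factor \<open>x\<close> outweighs the logarithm.
  Uniformity gives error bounds for partition entropy that do not depend on the measures.\<close>

lemma uniformly_continuous_mult_ln: "uniformly_continuous_on {0..1::real} (\<lambda>x. x * ln x)"
proof (rule compact_uniformly_continuous)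
  show "continuous_on {0..1} (\<lambda>x::real. x * ln x)"
    unfolding continuous_on_eq_continuous_within
  proof
    fix x :: real assume x: "x \<in> {0..1}"
    show "continuous (at x within {0..1}) (\<lambda>x. x * ln x)"
    proof (cases "x = 0")
      case True
      have "((\<lambda>x::real. x * ln x) \<longlongrightarrow> 0) (at_right 0)"
        by real_asymp
      then have "((\<lambda>x::real. x * ln x) \<longlongrightarrow> 0) (at 0 within {0..1})"
        using at_within_Icc_at_right[of 0 "1::real"] by simp
      then show ?thesis using True by (simp add: continuous_within)
    next
      case False
      then have "isCont (\<lambda>x. x * ln x) x" using x by (intro continuous_intros) auto
      then show ?thesis by (rule continuous_at_imp_continuous_at_within)
    qed
  qed
qed simp

section \<open>Regularity and supports\<close>

text \<open>The ambient type need not be Polish, so the regularity theorems of the library do not apply.\<close>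

lemma borel_closed_open_approx:
  fixes X :: "'a::metric_space set"
  assumes M: "finite_measure M" and sets: "sets M = sets (restrict_space borel X)"
    and B: "B \<in> sets borel" and e: "e > 0"
  shows "\<exists>C U. closed C \<and> open U \<and> C \<subseteq> B \<and> B \<subseteq> U \<and> measure M (X \<inter> (U - C)) < e"
proof -
  interpret finite_measure M by (rule M)
  have meas: "X \<inter> A \<in> sets M" if "A \<in> sets borel" for A
    using that unfolding sets sets_restrict_space by auto
  have "B \<in> sigma_sets UNIV {S. open S}"
    using B by (simp add: borel_def)
  then show ?thesis using e
  proof (induction arbitrary: e rule: sigma_sets.induct)
    case (Basic A)
    then have A: "open A" by simp
    show ?case
    \<comment> \<open>Treated apart because the distance to an empty complement is 0 by convention,
      so the shells below would not shrink.\<close>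
    proof (cases "A = UNIV")
      case True
      then have "closed A" "open A" "measure M (X \<inter> (A - A)) < e" using Basic(2) by simp_all
      then show ?thesis by blast
    next
      case False
      then have ne: "- A \<noteq> {}" by auto
      have cl: "closed (- A)" using A by (rule closed_Compl)
      \<comment> \<open>The shell of points of \<open>A\<close> closer than \<open>1 / Suc n\<close>
        to the complement. Removing it leaves a closed set, and the shells decrease to the empty
        set.\<close>
      define D where "D n = {x. infdist x (- A) < 1 / real (Suc n)} - (- A)" for n
      have oD: "open (D n \<union> - A)" for n
      proof -
        have "D n \<union> - A = {x. infdist x (- A) < 1 / real (Suc n)}"
          by (auto simp: D_def)
        moreover have "open {x. infdist x (- A) < 1 / real (Suc n)}"
          by (intro open_Collect_less continuous_intros)
        ultimately show ?thesis by simp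
      qed
      have bD: "D n \<in> sets borel" for n
      proof -
        have "D n = (D n \<union> - A) \<inter> A" by (auto simp: D_def)
        then show ?thesis using oD A by (metis borel_open open_Int)
      qed
      have inter: "(\<Inter>n. X \<inter> D n) = {}"
      proof (rule ccontr)
        assume "(\<Inter>n. X \<inter> D n) \<noteq> {}"
        then obtain x where x: "\<And>n. infdist x (- A) < 1 / real (Suc n)" "x \<in> A"
          by (auto simp: D_def)
        have "infdist x (- A) > 0"
          using x(2) cl ne by (metis ComplD in_closed_iff_infdist_zero infdist_nonneg less_eq_real_def)
        then obtain n where "1 / real (Suc n) < infdist x (- A)"
          using nat_approx_posE by metis
        then show False using x(1)[of n] by simp
      qed
      have "1 / real (Suc (Suc n)) \<le> 1 / real (Suc n)" for n by (intro frac_le) auto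
      then have "decseq (\<lambda>n. X \<inter> D n)"
        unfolding decseq_Suc_iff D_def by (blast intro: order_less_le_trans)
      then have "(\<lambda>n. measure M (X \<inter> D n)) \<longlonglongrightarrow> measure M (\<Inter>n. X \<inter> D n)"
        using meas[OF bD] by (intro finite_Lim_measure_decseq) auto
      then have "(\<lambda>n. measure M (X \<inter> D n)) \<longlonglongrightarrow> 0" using inter by simp
      then obtain n where n: "measure M (X \<inter> D n) < e"
        using Basic(2) order_tendstoD(2)[of _ 0 sequentially e] by (auto simp: eventually_sequentially)
      have "A - (- (D n \<union> - A)) = D n" by (auto simp: D_def)
      then have "measure M (X \<inter> (A - - (D n \<union> - A))) < e" using n by simp
      moreover have "closed (- (D n \<union> - A))" using oD by (rule closed_Compl)
      moreover have "- (D n \<union> - A) \<subseteq> A" by auto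
      ultimately show ?thesis using A by blast
    qed
  next
    case Empty
    then have "closed {}" "open {}" "measure M (X \<inter> ({} - {})) < e" by simp_all
    then show ?case by blast
  next
    case (Compl A)
    from Compl.IH[OF Compl.prems] obtain C U where
      "closed C" "open U" "C \<subseteq> A" "A \<subseteq> U" "measure M (X \<inter> (U - C)) < e" by blast
    moreover have "- C - - U = U - C" by auto
    moreover have "closed (- U)" "open (- C)" using calculation by (auto simp: closed_Compl open_Compl)
    moreover have "- U \<subseteq> UNIV - A" "UNIV - A \<subseteq> - C" using calculation by auto
    ultimately show ?case by metis
  next
    case (Union A)
    \<comment> \<open>These tolerances add up to \<open>e / 2\<close>. The other half of
      \<open>e\<close> pays for cutting the union of the \<open>C i\<close> down to finitely many,
      which keeps it closed.\<close>
    define d where "d i = e / 4 * (1 / 2) ^ i" for i :: nat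
    have "\<exists>C U. closed C \<and> open U \<and> C \<subseteq> A i \<and> A i \<subseteq> U \<and> measure M (X \<inter> (U - C)) < d i" for i
      using Union.IH[of "d i" i] Union.prems by (auto simp: d_def)
    then obtain C U where CU: "\<And>i. closed (C i)" "\<And>i. open (U i)" "\<And>i. C i \<subseteq> A i" "\<And>i. A i \<subseteq> U i"
      "\<And>i. measure M (X \<inter> (U i - C i)) < d i" by metis
    have bU: "U i \<in> sets borel" and bC: "C i \<in> sets borel" for i using CU by auto
    have dsum: "d sums (e / 2)"
      using sums_mult[OF geometric_sums[of "1 / 2 :: real"], of "e / 4"]
      unfolding d_def by (simp add: field_simps)
    define G where "G i = X \<inter> (U i - C i)" for i
    have G: "G i \<in> sets M" for i unfolding G_def using bU bC by (intro meas) simp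
    have Gd: "measure M (G i) \<le> d i" for i using CU(5)[of i] by (simp add: G_def)
    have sm: "summable (\<lambda>i. measure M (G i))"
      by (rule summable_comparison_test'[OF sums_summable[OF dsum], of 0]) (simp add: Gd)
    have "measure M (\<Union>i. G i) \<le> (\<Sum>i. measure M (G i))"
      by (rule finite_measure_subadditive_countably[OF _ sm]) (use G in auto)
    also have "\<dots> \<le> (\<Sum>i. d i)"
      by (rule suminf_le[OF Gd sm sums_summable[OF dsum]])
    finally have 1: "measure M (\<Union>i. G i) \<le> e / 2"
      using sums_unique[OF dsum] by simp
    define E where "E n = X \<inter> ((\<Union>i. C i) - (\<Union>i<n. C i))" for n
    have E: "E n \<in> sets M" for n unfolding E_def
      using bC by (intro meas sets.Diff sets.countable_UN'' sets.finite_UN) auto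
    have dec: "decseq E" unfolding decseq_Suc_iff E_def by (auto simp: less_Suc_eq)
    have "(\<lambda>n. measure M (E n)) \<longlonglongrightarrow> measure M (\<Inter>n. E n)"
      using E by (intro finite_Lim_measure_decseq dec) auto
    moreover have "(\<Inter>n. E n) = {}" unfolding E_def by blast
    ultimately have "(\<lambda>n. measure M (E n)) \<longlonglongrightarrow> 0" by simp
    then obtain n where n: "measure M (E n) < e / 2"
      using Union.prems order_tendstoD(2)[of _ 0 sequentially "e / 2"] by (auto simp: eventually_sequentially)
    have GE: "(\<Union>i. G i) \<union> E n \<in> sets M" "(\<Union>i. G i) \<in> sets M"
      using G E[of n] by (auto intro!: sets.Un sets.countable_UN'')
    have "measure M (X \<inter> ((\<Union>i. U i) - (\<Union>i<n. C i))) \<le> measure M ((\<Union>i. G i) \<union> E n)"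
      by (rule finite_measure_mono[OF _ GE(1)]) (unfold E_def G_def, blast)
    also have "\<dots> \<le> measure M (\<Union>i. G i) + measure M (E n)"
      by (rule measure_Un_le[OF GE(2) E])
    finally have "measure M (X \<inter> ((\<Union>i. U i) - (\<Union>i<n. C i))) < e" using 1 n by simp
    moreover have "closed (\<Union>i<n. C i)" "open (\<Union>i. U i)" using CU(1,2) by auto
    moreover have "(\<Union>i<n. C i) \<subseteq> (\<Union>i. A i)" "(\<Union>i. A i) \<subseteq> (\<Union>i. U i)"
      using CU(3,4) by blast+
    ultimately show ?case by blast
  qed
qed

text \<open>Closed inner approximations become compact after intersection with
  \<open>X\<close>.\<close>

lemma borel_prob_inner_compact:
  assumes "compact X" "borel_prob X M" "A \<in> sets M" "e > 0"
  shows "\<exists>C. compact C \<and> C \<subseteq> A \<and> C \<in> sets M \<and> measure M (A - C) < e"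
proof -
  interpret prob_space M using assms(2) by (simp add: borel_prob_def)
  have sets: "sets M = sets (restrict_space borel X)" using assms(2) by (simp add: borel_prob_def)
  obtain B where B: "B \<in> sets borel" "A = X \<inter> B"
    using assms(3) unfolding sets sets_restrict_space by auto
  obtain C U where CU: "closed C" "open U" "C \<subseteq> B" "B \<subseteq> U" "measure M (X \<inter> (U - C)) < e"
    using borel_closed_open_approx[OF finite_measure_axioms sets B(1) assms(4)] by blast
  have XC: "X \<inter> C \<in> sets M" and UC: "X \<inter> (U - C) \<in> sets M"
    unfolding sets sets_restrict_space using CU(1,2) by auto
  have "measure M (A - X \<inter> C) \<le> measure M (X \<inter> (U - C))"
    using CU(4) B(2) UC by (intro finite_measure_mono) auto
  then show ?thesis
    using CU B XC compact_Int_closed[OF assms(1) CU(1)] by (intro exI[of _ "X \<inter> C"]) auto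
qed

text \<open>A compact set disjoint from the support is covered by finitely many null balls, hence
  null; inner regularity extends this to the whole of \<open>X - Y\<close>.\<close>

lemma msupp_null:
  assumes X: "compact X" and M: "borel_prob X M" and Y: "closed Y" "msupp X M \<subseteq> Y"
  shows "AE x in M. x \<in> Y"
proof -
  interpret prob_space M using M by (simp add: borel_prob_def)
  have sets: "sets M = sets (restrict_space borel X)" and sp: "space M = X"
    using M by (simp_all add: borel_prob_def)
  have "X \<inter> - Y \<in> sets M"
    unfolding sets sets_restrict_space using Y(1) by (intro imageI borel_open) (rule open_Compl)
  then have YM: "X - Y \<in> sets M" by (simp add: Diff_eq)
  have null: "measure M C = 0" if C: "compact C" "C \<subseteq> X - Y" for C
  proof -
    have "\<exists>r>0. emeasure M (ball x r \<inter> X) = 0" if "x \<in> C" for x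
      using that C(2) Y(2) by (auto simp: msupp_def not_less zero_less_iff_neq_zero)
    then obtain r where r: "\<And>x. x \<in> C \<Longrightarrow> r x > 0 \<and> emeasure M (ball x (r x) \<inter> X) = 0" by metis
    have "C \<subseteq> (\<Union>x\<in>C. ball x (r x))" using r by force
    then obtain F where F: "F \<subseteq> C" "finite F" "C \<subseteq> (\<Union>x\<in>F. ball x (r x))"
      using compactE_image[OF C(1), of C "\<lambda>x. ball x (r x)"] by auto
    have "ball x (r x) \<inter> X \<in> sets M" for x
      unfolding sets sets_restrict_space by auto
    then have "ball x (r x) \<inter> X \<in> null_sets M" if "x \<in> F" for x
      using F(1) r that by (auto intro: null_setsI)
    then have "(\<Union>x\<in>F. ball x (r x) \<inter> X) \<in> null_sets M"
      using F(2) by (intro null_sets_UN' countable_finite) auto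
    moreover have "C \<subseteq> (\<Union>x\<in>F. ball x (r x) \<inter> X)" using F(3) C(2) by auto
    ultimately have "emeasure M C \<le> 0"
      by (metis (no_types, lifting) emeasure_mono null_setsD1 null_setsD2)
    then show ?thesis by (simp add: measure_def)
  qed
  have "measure M (X - Y) = 0"
  proof (rule ccontr)
    assume "measure M (X - Y) \<noteq> 0"
    then have pos: "measure M (X - Y) > 0" by (simp add: zero_less_measure_iff)
    obtain C where C: "compact C" "C \<subseteq> X - Y" "C \<in> sets M" "measure M (X - Y - C) < measure M (X - Y)"
      using borel_prob_inner_compact[OF X M YM pos] by blast
    then show False
      using null[OF C(1,2)] finite_measure_Diff[OF YM C(3,2)] by simp
  qed
  then show ?thesis
    using YM sp by (intro AE_I[of _ _ "X - Y"]) (auto simp: emeasure_eq_measure)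
qed

section \<open>Counting orbits in Bowen balls\<close>

lemma C0_funpow:
  assumes "g \<in> C0 X"
  shows "continuous_on X (g ^^ n)" "x \<in> X \<Longrightarrow> (g ^^ n) x \<in> X"
proof -
  have g: "continuous_on X g" "g ` X \<subseteq> X" using assms by (auto simp: C0_def)
  have "continuous_on X (g ^^ n) \<and> (g ^^ n) ` X \<subseteq> X"
  proof (induction n)
    case (Suc n)
    then have "continuous_on X (g \<circ> (g ^^ n))"
      using g by (intro continuous_on_compose) (auto intro: continuous_on_subset)
    then show ?case using Suc g(2) by (auto simp: comp_def)
  qed (auto simp: id_def)
  then show "continuous_on X (g ^^ n)" "x \<in> X \<Longrightarrow> (g ^^ n) x \<in> X" by auto
qed

text \<open>\<open>Gamma\<close> is formulated with \<open>inv_into X g\<close>, which agrees on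
  \<open>X\<close> with the continuous inverse supplied by \<open>homeomorphism\<close>.\<close>

lemma homeos_inv_into:
  assumes "g \<in> homeos X"
  shows "inv_into X g \<in> C0 X" "x \<in> X \<Longrightarrow> inv_into X g (g x) = x"
proof -
  obtain h where h: "homeomorphism X X g h" using assms by (auto simp: homeos_def)
  have inj: "inj_on g X" using h by (metis homeomorphism_def inj_on_inverseI)
  then show "x \<in> X \<Longrightarrow> inv_into X g (g x) = x" by simp
  have eq: "inv_into X g x = h x" if "x \<in> X" for x
    using that h inj by (metis homeomorphism_def image_eqI inv_into_f_f)
  have "continuous_on X (inv_into X g)"
    using h eq by (metis continuous_on_cong homeomorphism_def)
  moreover have "inv_into X g ` X \<subseteq> X" using eq h by (auto simp: homeomorphism_def)
  ultimately show "inv_into X g \<in> C0 X" by (simp add: C0_def)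
qed

lemma homeos_subset_C0: "homeos X \<subseteq> C0 X"
  by (auto simp: homeos_def C0_def homeomorphism_def)

lemma continuous_on_iter_int:
  assumes "g \<in> homeos X"
  shows "continuous_on X (iter_int X g k)"
  using C0_funpow[of g X] C0_funpow[OF homeos_inv_into(1)[OF assms]] assms homeos_subset_C0[of X]
  unfolding iter_int_def by auto

lemma inv_into_funpow:
  assumes "g \<in> homeos X" "x \<in> X"
  shows "(inv_into X g ^^ j) ((g ^^ (j + t)) x) = (g ^^ t) x"
proof (induction j)
  case (Suc j)
  have "(inv_into X g ^^ Suc j) ((g ^^ (Suc j + t)) x)
      = (inv_into X g ^^ j) (inv_into X g (g ((g ^^ (j + t)) x)))"
    by (simp add: funpow_swap1)
  also have "inv_into X g (g ((g ^^ (j + t)) x)) = (g ^^ (j + t)) x"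
    using assms homeos_subset_C0[of X] by (intro homeos_inv_into(2) C0_funpow(2)) auto
  finally show ?case using Suc by simp
qed simp

text \<open>Reads a two-sided window around time \<open>t\<close> off the forward orbit of
  \<open>x\<close>, as long as the window does not reach below time 0. This is the reason for the
  bound \<open>m \<le> t\<close> in the proof of \<open>bowen_ball_count\<close>.\<close>

lemma iter_int_funpow:
  assumes "g \<in> homeos X" "x \<in> X" "0 \<le> int t + k"
  shows "iter_int X g k ((g ^^ t) x) = (g ^^ nat (int t + k)) x"
proof (cases "k \<ge> 0")
  case True
  then have "nat (int t + k) = nat k + t" by simp
  then show ?thesis using True by (simp add: iter_int_def funpow_add)
next
  case False
  then have "t = nat (- k) + nat (int t + k)" using assms(3) by simp
  then show ?thesis
    using False inv_into_funpow[OF assms(1,2), of "nat (- k)" "nat (int t + k)"]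
    by (simp add: iter_int_def)
qed

section \<open>Spanning sets and their use near \<open>Gamma\<close>\<close>

definition spans :: "('a::metric_space \<Rightarrow> 'a) \<Rightarrow> 'a set \<Rightarrow> nat \<Rightarrow> real \<Rightarrow> 'a set \<Rightarrow> bool" where
  "spans f K n \<delta> E \<longleftrightarrow> (\<forall>y\<in>K. \<exists>e\<in>E. \<forall>j<n. dist ((f ^^ j) y) ((f ^^ j) e) \<le> \<delta>)"

lemma finite_spanning_set_exists:
  fixes X :: "'a::metric_space set"
  assumes X: "compact X" and f: "f \<in> C0 X" and d: "\<delta> > 0" and K: "K \<subseteq> X"
  shows "\<exists>E. finite E \<and> E \<subseteq> X \<and> spans f K n \<delta> E"
proof -
  have "\<exists>r>0. \<forall>y\<in>X. dist y x < r \<longrightarrow> (\<forall>j<n. dist ((f ^^ j) y) ((f ^^ j) x) \<le> \<delta>)" if x: "x \<in> X" for x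
  proof (induction n)
    case (Suc n)
    then obtain r where r: "r > 0" "\<forall>y\<in>X. dist y x < r \<longrightarrow> (\<forall>j<n. dist ((f ^^ j) y) ((f ^^ j) x) \<le> \<delta>)"
      by blast
    obtain s where s: "s > 0" "\<forall>y\<in>X. dist y x < s \<longrightarrow> dist ((f ^^ n) y) ((f ^^ n) x) < \<delta>"
      using C0_funpow(1)[OF f, of n] x d unfolding continuous_on_iff by blast
    show ?case using r s by (intro exI[of _ "min r s"]) (auto simp: less_Suc_eq intro: less_imp_le)
  qed (auto intro: exI[of _ 1])
  then obtain r where r: "\<And>x. x \<in> X \<Longrightarrow> r x > 0"
    "\<And>x y. x \<in> X \<Longrightarrow> y \<in> X \<Longrightarrow> dist y x < r x \<Longrightarrow> \<forall>j<n. dist ((f ^^ j) y) ((f ^^ j) x) \<le> \<delta>"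
    by metis
  have "X \<subseteq> (\<Union>x\<in>X. ball x (r x))" using r(1) by force
  then obtain E where E: "E \<subseteq> X" "finite E" "X \<subseteq> (\<Union>x\<in>E. ball x (r x))"
    using compactE_image[OF X, of X "\<lambda>x. ball x (r x)"] by auto
  have "spans f K n \<delta> E"
    unfolding spans_def
  proof
    fix y assume y: "y \<in> K"
    then obtain e where e: "e \<in> E" "dist y e < r e" using E(3) K by (force simp: dist_commute)
    then show "\<exists>e\<in>E. \<forall>j<n. dist ((f ^^ j) y) ((f ^^ j) e) \<le> \<delta>"
      using r(2)[of e y] E(1) K y by blast
  qed
  then show ?thesis using E by blast
qed

text \<open>\<open>span_num\<close> is an infimum of naturals over a set that compactness makes
  nonempty, hence a minimum.\<close>

lemma span_num_attained:
  assumes "compact X" "f \<in> C0 X" "\<delta> > 0" "K \<subseteq> X"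
  obtains E where "finite E" "E \<subseteq> X" "card E = span_num X f K n \<delta>" "spans f K n \<delta> E"
proof -
  let ?S = "{card E |E. finite E \<and> E \<subseteq> X \<and> spans f K n \<delta> E}"
  have "?S \<noteq> {}" using finite_spanning_set_exists[OF assms, of n] by blast
  then have "span_num X f K n \<delta> \<in> ?S" unfolding span_num_def spans_def by (rule Inf_nat_def1)
  then show thesis using that by (elim CollectE exE conjE) simp
qed

lemma span_num_antimono:
  assumes "compact X" "f \<in> C0 X" "\<delta> > 0" "K \<subseteq> X" "\<delta> \<le> \<delta>'"
  shows "span_num X f K n \<delta>' \<le> span_num X f K n \<delta>"
proof -
  obtain E where E: "finite E" "E \<subseteq> X" "card E = span_num X f K n \<delta>" "spans f K n \<delta> E"
    by (rule span_num_attained[OF assms(1-4)])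
  have le: "r \<le> \<delta> \<Longrightarrow> r \<le> \<delta>'" for r using assms(5) by simp
  have "spans f K n \<delta>' E" using E(4) le unfolding spans_def by blast
  then have "card E \<in> {card E |E. finite E \<and> E \<subseteq> X \<and> spans f K n \<delta>' E}" using E(1,2) by blast
  then have "span_num X f K n \<delta>' \<le> card E"
    unfolding span_num_def spans_def[symmetric] by (intro cInf_lower) auto
  then show ?thesis by (simp add: E(3))
qed

text \<open>Growth rates increase as the scale shrinks, so the limit in \<open>htop\<close> is a
  supremum over all scales. Entropy 0 therefore bounds the growth rate at each single scale by
  0.\<close>

lemma htop_0_imp_spanning:
  assumes X: "compact X" "f \<in> C0 X" and K: "K \<subseteq> X" and h: "htop X f K = 0"
    and d: "\<delta> > 0" and a: "a > 0"
  shows "\<exists>n E. n \<ge> 1 \<and> finite E \<and> E \<subseteq> X \<and> real (card E) \<le> exp (a * real n) \<and> spans f K n \<delta> E"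
proof -
  define L where "L \<delta> = limsup (\<lambda>n. ereal (ln (real (span_num X f K n \<delta>)) / real n))" for \<delta>
  have mono: "L s \<le> L r" if "0 < r" "r \<le> s" for r s
    unfolding L_def
  proof (rule Limsup_mono, rule always_eventually, rule allI)
    fix n
    \<comment> \<open>An empty \<open>K\<close> has spanning number 0, so the zero cases are
      separated from monotonicity of \<open>ln\<close>.\<close>
    have "ln (real (span_num X f K n s)) \<le> ln (real (span_num X f K n r))"
      using span_num_antimono[OF X that(1) K that(2), of n]
      by (cases "span_num X f K n s = 0"; cases "span_num X f K n r = 0") auto
    then show "ereal (ln (real (span_num X f K n s)) / real n) \<le> ereal (ln (real (span_num X f K n r)) / real n)"
      by (simp add: divide_right_mono)
  qed
  define S where "S = (SUP r\<in>{0<..}. L r)"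
  have "(L \<longlongrightarrow> S) (at_right 0)"
  proof (rule order_tendstoI)
    fix b assume "b < S"
    then obtain r where r: "r > 0" "b < L r" by (auto simp: S_def less_SUP_iff)
    then show "\<forall>\<^sub>F s in at_right 0. b < L s"
      unfolding eventually_at_right[OF zero_less_one]
      using mono[of _ r] by (intro exI[of _ r]) (auto intro: order_less_le_trans less_imp_le)
  next
    fix b assume "S < b"
    then have "L r < b" if "r > 0" for r
      using that SUP_upper[of r "{0<..}" L] by (auto simp: S_def intro: order_le_less_trans)
    then show "\<forall>\<^sub>F s in at_right 0. L s < b"
      by (auto simp: eventually_at_right[OF zero_less_one] intro: exI[of _ 1])
  qed
  then have "htop X f K = S" unfolding htop_def L_def by (intro tendsto_Lim) auto
  then have "L \<delta> \<le> 0" using h d SUP_upper[of \<delta> "{0<..}" L] by (simp add: S_def)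
  also have "0 < ereal a" using a by simp
  finally have "\<forall>\<^sub>F n in sequentially. ereal (ln (real (span_num X f K n \<delta>)) / real n) < ereal a"
    unfolding L_def by (rule Limsup_lessD)
  then have "\<forall>\<^sub>F n in sequentially. n \<ge> 1 \<and> ln (real (span_num X f K n \<delta>)) / real n < a"
    using eventually_ge_at_top[of "1::nat"] by eventually_elim auto
  then obtain n where n: "n \<ge> 1" "ln (real (span_num X f K n \<delta>)) / real n < a"
    by (auto simp: eventually_sequentially)
  obtain E where E: "finite E" "E \<subseteq> X" "card E = span_num X f K n \<delta>" "spans f K n \<delta> E"
    by (rule span_num_attained[OF X d K])
  have le: "ln (real (card E)) \<le> a * real n" using n E(3) by (simp add: field_simps)
  have "real (card E) \<le> exp (a * real n)"
  proof (cases "card E = 0")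
    case False
    then have "real (card E) = exp (ln (real (card E)))" by simp
    also have "\<dots> \<le> exp (a * real n)" using le by simp
    finally show ?thesis .
  qed simp
  then show ?thesis using n E by blast
qed

text \<open>A compactness argument. If every \<open>k\<close> had a bad pair, a limit
  \<open>z\<close> of the second components would stay \<open>\<epsilon>\<close>-close to
  \<open>y\<close> for all integer times, hence lie in \<open>Gamma\<close> and be spanned by
  \<open>E\<close>. The same \<open>k\<close> controls both the neighbourhood of \<open>y\<close>
  and the length of the window.\<close>

lemma Gamma_local_spanning:
  fixes X :: "'a::metric_space set"
  assumes X: "compact X" and g: "g \<in> homeos X" and y: "y \<in> X"
    and h: "htop X g (Gamma X \<epsilon> y g) = 0" and d: "\<delta> > 0" and a: "a > 0"
  shows "\<exists>n E k. n \<ge> 1 \<and> finite E \<and> E \<subseteq> X \<and> real (card E) \<le> exp (a * real n) \<and>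
    (\<forall>y'\<in>X. \<forall>z\<in>X. dist y' y < 1 / real (Suc k) \<longrightarrow>
       (\<forall>i. \<bar>i\<bar> \<le> int k \<longrightarrow> dist (iter_int X g i z) (iter_int X g i y') \<le> \<epsilon>) \<longrightarrow>
       (\<exists>e\<in>E. \<forall>j<n. dist ((g ^^ j) z) ((g ^^ j) e) < 2 * \<delta>))"
proof -
  have gC: "g \<in> C0 X" using g homeos_subset_C0 by auto
  have "Gamma X \<epsilon> y g \<subseteq> X" by (auto simp: Gamma_def)
  from htop_0_imp_spanning[OF X gC this h d a] obtain n E where
    nE: "n \<ge> 1" "finite E" "E \<subseteq> X" "real (card E) \<le> exp (a * real n)" "spans g (Gamma X \<epsilon> y g) n \<delta> E"
    by blast
  let ?P = "\<lambda>k y' z. dist y' y < 1 / real (Suc k) \<and>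
       (\<forall>i. \<bar>i\<bar> \<le> int k \<longrightarrow> dist (iter_int X g i z) (iter_int X g i y') \<le> \<epsilon>)"
  let ?Q = "\<lambda>z. \<exists>e\<in>E. \<forall>j<n. dist ((g ^^ j) z) ((g ^^ j) e) < 2 * \<delta>"
  have "\<exists>k. \<forall>y'\<in>X. \<forall>z\<in>X. ?P k y' z \<longrightarrow> ?Q z"
  proof (rule ccontr)
    assume "\<not> ?thesis"
    then have "\<forall>k. \<exists>y' z. y' \<in> X \<and> z \<in> X \<and> ?P k y' z \<and> \<not> ?Q z" by blast
    then obtain u v where uv: "\<And>k. u k \<in> X" "\<And>k. v k \<in> X" "\<And>k. ?P k (u k) (v k)" "\<And>k. \<not> ?Q (v k)"
      by metis
    obtain z s where z: "z \<in> X" "strict_mono s" "(v \<circ> s) \<longlonglongrightarrow> z"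
    proof -
      have "\<exists>l\<in>X. \<exists>r. strict_mono r \<and> (v \<circ> r) \<longlonglongrightarrow> l"
        using X uv(2) by (simp add: compact_def)
      then show thesis using that by blast
    qed
    have "(\<lambda>k. dist (u k) y) \<longlonglongrightarrow> 0"
    proof (rule tendsto_sandwich[of "\<lambda>_. 0" _ _ "\<lambda>k. 1 / real (Suc k)"])
      have "dist (u k) y \<le> 1 / real (Suc k)" for k using uv(3)[of k] by (intro less_imp_le) blast
      then show "\<forall>\<^sub>F k in sequentially. dist (u k) y \<le> 1 / real (Suc k)"
        by (rule always_eventually[OF allI])
      show "(\<lambda>k. 1 / real (Suc k)) \<longlonglongrightarrow> 0"
        using LIMSEQ_inverse_real_of_nat unfolding inverse_eq_divide .
    qed simp_all
    then have "u \<longlonglongrightarrow> y" by (simp only: tendsto_dist_iff[of u y])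
    then have us: "(\<lambda>k. u (s k)) \<longlonglongrightarrow> y"
      using z(2) LIMSEQ_subseq_LIMSEQ[of u y s] by (simp add: comp_def)
    have vs: "(\<lambda>k. v (s k)) \<longlonglongrightarrow> z" using z(3) by (simp add: comp_def)
    have "dist (iter_int X g i z) (iter_int X g i y) \<le> \<epsilon>" for i
    proof -
      have "(\<lambda>k. iter_int X g i (v (s k))) \<longlonglongrightarrow> iter_int X g i z"
        using z(1) vs uv(2) by (intro continuous_on_tendsto_compose[OF continuous_on_iter_int[OF g]]) auto
      moreover have "(\<lambda>k. iter_int X g i (u (s k))) \<longlonglongrightarrow> iter_int X g i y"
        using us y uv(1) by (intro continuous_on_tendsto_compose[OF continuous_on_iter_int[OF g]]) auto
      ultimately have lim: "(\<lambda>k. dist (iter_int X g i (v (s k))) (iter_int X g i (u (s k))))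
          \<longlonglongrightarrow> dist (iter_int X g i z) (iter_int X g i y)" by (rule tendsto_dist)
      \<comment> \<open>A fixed time \<open>i\<close> eventually lies in the window of the
        \<open>k\<close>-th chosen pair, because \<open>k \<le> s k\<close>.\<close>
      have "dist (iter_int X g i (v (s k))) (iter_int X g i (u (s k))) \<le> \<epsilon>" if "k \<ge> nat \<bar>i\<bar>" for k
      proof -
        have "\<bar>i\<bar> \<le> int (s k)" using that seq_suble[OF z(2), of k] by linarith
        then show ?thesis using uv(3)[of "s k"] by simp
      qed
      then show ?thesis by (intro LIMSEQ_le_const2[OF lim]) blast
    qed
    then have "z \<in> Gamma X \<epsilon> y g" using z(1) by (simp add: Gamma_def)
    then obtain e where e: "e \<in> E" "\<And>j. j < n \<Longrightarrow> dist ((g ^^ j) z) ((g ^^ j) e) \<le> \<delta>"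
      using nE(5) unfolding spans_def by blast
    have "\<forall>\<^sub>F k in sequentially. \<forall>j\<in>{..<n}. dist ((g ^^ j) (v (s k))) ((g ^^ j) e) < 2 * \<delta>"
    proof (rule eventually_ball_finite, simp, rule ballI)
      fix j assume j: "j \<in> {..<n}"
      have "(\<lambda>k. (g ^^ j) (v (s k))) \<longlonglongrightarrow> (g ^^ j) z"
        using z(1) vs uv(2) by (intro continuous_on_tendsto_compose[OF C0_funpow(1)[OF gC]]) auto
      then have "(\<lambda>k. dist ((g ^^ j) (v (s k))) ((g ^^ j) e)) \<longlonglongrightarrow> dist ((g ^^ j) z) ((g ^^ j) e)"
        by (intro tendsto_intros)
      \<comment> \<open>The slack between \<open>\<delta>\<close> and \<open>2 * \<delta>\<close>
        gives a strict inequality, which passes from \<open>z\<close> to nearby points of the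
        sequence.\<close>
      moreover have "dist ((g ^^ j) z) ((g ^^ j) e) < 2 * \<delta>" using e(2)[of j] j d by auto
      ultimately show "\<forall>\<^sub>F k in sequentially. dist ((g ^^ j) (v (s k))) ((g ^^ j) e) < 2 * \<delta>"
        by (rule order_tendstoD)
    qed
    then obtain k where "\<forall>j\<in>{..<n}. dist ((g ^^ j) (v (s k))) ((g ^^ j) e) < 2 * \<delta>"
      by (auto simp: eventually_sequentially)
    then show False using uv(4)[of "s k"] e(1) by blast
  qed
  then obtain k where k: "\<forall>y'\<in>X. \<forall>z\<in>X. ?P k y' z \<longrightarrow> ?Q z" by (elim exE)
  show ?thesis
  proof (rule exI[of _ n], rule exI[of _ E], rule exI[of _ k], intro conjI nE ballI impI)
    fix y' z assume "y' \<in> X" "z \<in> X" "dist y' y < 1 / real (Suc k)"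
      "\<forall>i. \<bar>i\<bar> \<le> int k \<longrightarrow> dist (iter_int X g i z) (iter_int X g i y') \<le> \<epsilon>"
    then show "?Q z" using k by simp
  qed
qed

text \<open>The orbit of \<open>x\<close> is cut into blocks on which the local spanning sets apply; their
lengths are bounded, so the last block overshoots time \<open>n\<close> by at most \<open>N\<close>.\<close>

lemma bowen_ball_count:
  fixes X :: "'a::metric_space set"
  assumes X: "compact X" and Y: "compact Y" "Y \<subseteq> X" and g: "g \<in> homeos X"
    and h: "\<forall>y\<in>Y. htop X g (Gamma X \<epsilon> y g) = 0" and d: "\<delta> > 0" and a: "a > 0"
  shows "\<exists>m N. \<forall>n x. x \<in> X \<longrightarrow> (\<forall>t. (g ^^ t) x \<in> Y) \<longrightarrow>
    (\<exists>D. finite D \<and> real (card D) \<le> exp (a * real (n + N)) \<and>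
       {z\<in>X. \<forall>j\<le>n + 2 * m. dist ((g ^^ j) z) ((g ^^ j) x) \<le> \<epsilon>} \<subseteq> \<Union>D \<and>
       (\<forall>A\<in>D. \<forall>z\<in>A. \<forall>z'\<in>A. \<forall>j<n. dist ((g ^^ (m + j)) z) ((g ^^ (m + j)) z') < 4 * \<delta>))"
proof -
  have "\<forall>y\<in>Y. \<exists>n E k. n \<ge> 1 \<and> finite E \<and> E \<subseteq> X \<and> real (card E) \<le> exp (a * real n) \<and>
    (\<forall>y'\<in>X. \<forall>z\<in>X. dist y' y < 1 / real (Suc k) \<longrightarrow>
       (\<forall>i. \<bar>i\<bar> \<le> int k \<longrightarrow> dist (iter_int X g i z) (iter_int X g i y') \<le> \<epsilon>) \<longrightarrow>
       (\<exists>e\<in>E. \<forall>j<n. dist ((g ^^ j) z) ((g ^^ j) e) < 2 * \<delta>))"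
    using Gamma_local_spanning[OF X g _ bspec[OF h] d a] Y(2) by blast
  then obtain l E k where lEk: "\<And>y. y \<in> Y \<Longrightarrow> l y \<ge> 1 \<and> finite (E y) \<and> real (card (E y)) \<le> exp (a * real (l y :: nat))"
    "\<And>y y' z. y \<in> Y \<Longrightarrow> y' \<in> X \<Longrightarrow> z \<in> X \<Longrightarrow> dist y' y < 1 / real (Suc (k y)) \<Longrightarrow>
       (\<forall>i. \<bar>i\<bar> \<le> int (k y) \<longrightarrow> dist (iter_int X g i z) (iter_int X g i y') \<le> \<epsilon>) \<Longrightarrow>
       (\<exists>e\<in>E y. \<forall>j<l y. dist ((g ^^ j) z) ((g ^^ j) e) < 2 * \<delta>)"
    by metis
  have "Y \<subseteq> (\<Union>y\<in>Y. ball y (1 / real (Suc (k y))))" by force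
  then obtain F where F: "F \<subseteq> Y" "finite F" "Y \<subseteq> (\<Union>y\<in>F. ball y (1 / real (Suc (k y))))"
    using compactE_image[OF Y(1), of Y "\<lambda>y. ball y (1 / real (Suc (k y)))"] by auto
  \<comment> \<open>The sums are convenient upper bounds for all window sizes and all block lengths
    of the finite subcover.\<close>
  define m where "m = (\<Sum>y\<in>F. k y)"
  define N where "N = (\<Sum>y\<in>F. l y)"
  have m: "k y \<le> m" and N: "l y \<le> N" if "y \<in> F" for y
    unfolding m_def N_def using that F(2) by (auto intro: member_le_sum)
  have gC: "g \<in> C0 X" using g homeos_subset_C0 by auto
  \<comment> \<open>Strong induction on the number \<open>n\<close> of times still to be controlled
    from time \<open>t\<close> on. The past half of each window fits because
    \<open>m \<le> t\<close>, the future half because closeness is assumed up to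
    \<open>t + n + m\<close>.\<close>
  have main: "\<exists>D. finite D \<and> real (card D) \<le> exp (a * (if n = 0 then 0 else real (n + N))) \<and>
       {z\<in>X. \<forall>j\<le>t + n + m. dist ((g ^^ j) z) ((g ^^ j) x) \<le> \<epsilon>} \<subseteq> \<Union>D \<and>
       (\<forall>A\<in>D. \<forall>z\<in>A. \<forall>z'\<in>A. \<forall>j<n. dist ((g ^^ (t + j)) z) ((g ^^ (t + j)) z') < 4 * \<delta>)"
    if x: "x \<in> X" "\<forall>t. (g ^^ t) x \<in> Y" and t: "m \<le> t" for x t n
    using t
  proof (induction n arbitrary: t rule: less_induct)
    case (less n)
    show ?case
    proof (cases "n = 0")
      case True
      then show ?thesis by (intro exI[of _ "{X}"]) auto
    next
      case n: False
      obtain y where y: "y \<in> F" "dist ((g ^^ t) x) y < 1 / real (Suc (k y))"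
        using F(3) x(2) by (force simp: dist_commute)
      have yY: "y \<in> Y" using y(1) F(1) by blast
      note ly = lEk(1)[OF yY]
      define B where "B e = {z. \<forall>j<l y. dist ((g ^^ (t + j)) z) ((g ^^ j) e) < 2 * \<delta>}" for e
      \<comment> \<open>Sets that are small after the current block. The division by
        \<open>exp (a * real (l y))\<close> leaves room for the factor
        \<open>card (E y)\<close>.\<close>
      have "\<exists>D. finite D \<and> real (card D) \<le> exp (a * real (n + N)) / exp (a * real (l y)) \<and>
        {z\<in>X. \<forall>j\<le>t + n + m. dist ((g ^^ j) z) ((g ^^ j) x) \<le> \<epsilon>} \<subseteq> \<Union>D \<and>
        (\<forall>A\<in>D. \<forall>z\<in>A. \<forall>z'\<in>A. \<forall>j. l y \<le> j \<longrightarrow> j < n \<longrightarrow>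
           dist ((g ^^ (t + j)) z) ((g ^^ (t + j)) z') < 4 * \<delta>)"
      proof (cases "n \<le> l y")
        case True
        have "a * real (l y) \<le> a * real (n + N)"
          using N[OF y(1)] a by (intro mult_left_mono) auto
        \<comment> \<open>In the last block no later time remains, so one set suffices; the quotient
          is at least 1 because \<open>l y \<le> N\<close>.\<close>
        then show ?thesis using True by (intro exI[of _ "{UNIV}"]) auto
      next
        case False
        then have eq: "t + l y + (n - l y) + m = t + n + m" and pos: "n - l y \<noteq> 0" and lt: "n - l y < n"
          using ly by auto
        have "m \<le> t + l y" using less.prems by simp
        from less.IH[OF lt this, unfolded eq if_not_P[OF pos]] obtain D where D: "finite D"
          "real (card D) \<le> exp (a * real (n - l y + N))"
          "{z\<in>X. \<forall>j\<le>t + n + m. dist ((g ^^ j) z) ((g ^^ j) x) \<le> \<epsilon>} \<subseteq> \<Union>D"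
          "\<forall>A\<in>D. \<forall>z\<in>A. \<forall>z'\<in>A. \<forall>j<n - l y. dist ((g ^^ (t + l y + j)) z) ((g ^^ (t + l y + j)) z') < 4 * \<delta>"
          by (elim exE conjE) (rule that)
        have "exp (a * real (n - l y + N)) = exp (a * real (n + N)) / exp (a * real (l y))"
          using False by (simp add: exp_diff[symmetric] of_nat_diff algebra_simps)
        moreover have "dist ((g ^^ (t + j)) z) ((g ^^ (t + j)) z') < 4 * \<delta>"
          if "A \<in> D" "z \<in> A" "z' \<in> A" "l y \<le> j" "j < n" for A z z' j
        proof -
          have "t + l y + (j - l y) = t + j" "j - l y < n - l y" using that by auto
          then show ?thesis using D(4) that(1-3) by metis
        qed
        ultimately show ?thesis using D(1-3) by (intro exI[of _ D]) simp
      qed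
      then obtain D where D: "finite D" "real (card D) \<le> exp (a * real (n + N)) / exp (a * real (l y))"
        "{z\<in>X. \<forall>j\<le>t + n + m. dist ((g ^^ j) z) ((g ^^ j) x) \<le> \<epsilon>} \<subseteq> \<Union>D"
        "\<forall>A\<in>D. \<forall>z\<in>A. \<forall>z'\<in>A. \<forall>j. l y \<le> j \<longrightarrow> j < n \<longrightarrow>
           dist ((g ^^ (t + j)) z) ((g ^^ (t + j)) z') < 4 * \<delta>"
        by (elim exE conjE) (rule that)
      \<comment> \<open>Each set handling the later times is cut by the tubes \<open>B e\<close>,
        which handle the current block. Two points in one tube are less than
        \<open>4 * \<delta>\<close> apart there.\<close>
      define D' where "D' = (\<lambda>(A, e). A \<inter> B e) ` (D \<times> E y)"
      have "finite D'" using D(1) ly by (simp add: D'_def)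
      moreover have "real (card D') \<le> exp (a * real (n + N))"
      proof -
        have "card D' \<le> card D * card (E y)"
          unfolding D'_def using card_image_le[of "D \<times> E y"] D(1) ly by (simp add: card_cartesian_product)
        then have "real (card D') \<le> real (card D) * real (card (E y))"
          by (metis of_nat_le_iff of_nat_mult)
        also have "\<dots> \<le> (exp (a * real (n + N)) / exp (a * real (l y))) * exp (a * real (l y))"
          using D(2) ly by (intro mult_mono) auto
        finally show ?thesis by simp
      qed
      moreover have "{z\<in>X. \<forall>j\<le>t + n + m. dist ((g ^^ j) z) ((g ^^ j) x) \<le> \<epsilon>} \<subseteq> \<Union>D'"
      proof
        fix z assume z: "z \<in> {z\<in>X. \<forall>j\<le>t + n + m. dist ((g ^^ j) z) ((g ^^ j) x) \<le> \<epsilon>}"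
        then obtain A where A: "A \<in> D" "z \<in> A" using D(3) by blast
        have "dist (iter_int X g i ((g ^^ t) z)) (iter_int X g i ((g ^^ t) x)) \<le> \<epsilon>"
          if i: "\<bar>i\<bar> \<le> int (k y)" for i
        proof -
          have "0 \<le> int t + i" "nat (int t + i) \<le> t + n + m"
            using i m[OF y(1)] less.prems by linarith+
          then show ?thesis using z x(1) by (simp add: iter_int_funpow[OF g])
        qed
        then have "\<exists>e\<in>E y. \<forall>j<l y. dist ((g ^^ j) ((g ^^ t) z)) ((g ^^ j) e) < 2 * \<delta>"
          using z x(1) y(2) C0_funpow(2)[OF gC, of _ t] by (intro lEk(2)[OF yY, of "(g ^^ t) x"]) auto
        then obtain e where e: "e \<in> E y" "\<And>j. j < l y \<Longrightarrow> dist ((g ^^ j) ((g ^^ t) z)) ((g ^^ j) e) < 2 * \<delta>"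
          by blast
        have "(g ^^ j) ((g ^^ t) z) = (g ^^ (t + j)) z" for j
          by (metis add.commute comp_apply funpow_add)
        then have "z \<in> B e" using e(2) by (simp add: B_def)
        then show "z \<in> \<Union>D'" using A e(1) by (auto simp: D'_def)
      qed
      moreover have "dist ((g ^^ (t + j)) z) ((g ^^ (t + j)) z') < 4 * \<delta>"
        if A': "A' \<in> D'" "z \<in> A'" "z' \<in> A'" "j < n" for A' z z' j
      proof -
        obtain A e where A: "A \<in> D" "e \<in> E y" "A' = A \<inter> B e" using A'(1) by (auto simp: D'_def)
        show ?thesis
        proof (cases "j < l y")
          case True
          then have "dist ((g ^^ (t + j)) z) ((g ^^ j) e) < 2 * \<delta>" "dist ((g ^^ (t + j)) z') ((g ^^ j) e) < 2 * \<delta>"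
            using that A by (auto simp: B_def)
          then show ?thesis
            using dist_triangle2[of "(g ^^ (t + j)) z" "(g ^^ (t + j)) z'" "(g ^^ j) e"] by linarith
        qed (use D(4) that A in auto)
      qed
      ultimately show ?thesis using n by (intro exI[of _ D']) simp
    qed
  qed
  have count: "\<exists>D. finite D \<and> real (card D) \<le> exp (a * real (n + N)) \<and>
       {z\<in>X. \<forall>j\<le>n + 2 * m. dist ((g ^^ j) z) ((g ^^ j) x) \<le> \<epsilon>} \<subseteq> \<Union>D \<and>
       (\<forall>A\<in>D. \<forall>z\<in>A. \<forall>z'\<in>A. \<forall>j<n. dist ((g ^^ (m + j)) z) ((g ^^ (m + j)) z') < 4 * \<delta>)"
    if x: "x \<in> X" "\<forall>t. (g ^^ t) x \<in> Y" for x n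
  proof -
    \<comment> \<open>Starting at time \<open>m\<close>, the earliest admissible one, needs
      \<open>m\<close> extra times before and \<open>m\<close> after.\<close>
    have eq: "m + n + m = n + 2 * m" by simp
    have le: "exp (a * (if n = 0 then 0 else real (n + N))) \<le> exp (a * real (n + N))"
      using a by simp
    from main[OF x order_refl, of n, unfolded eq] show ?thesis
      by (elim ex_forward conj_forward) (assumption | erule order_trans[OF _ le])+
  qed
  show ?thesis
    by (rule exI[of _ m], rule exI[of _ N]) (use count in simp)
qed

section \<open>Partitions of small diameter\<close>

lemma finite_compact_separation:
  fixes C :: "'b \<Rightarrow> 'a::metric_space set"
  assumes "finite I" "\<And>v. v \<in> I \<Longrightarrow> compact (C v)"
    and disj: "\<And>v w. v \<in> I \<Longrightarrow> w \<in> I \<Longrightarrow> v \<noteq> w \<Longrightarrow> C v \<inter> C w = {}"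
  shows "\<exists>\<rho>>0. \<forall>v\<in>I. \<forall>w\<in>I. \<forall>x\<in>C v. \<forall>y\<in>C w. dist x y < \<rho> \<longrightarrow> v = w"
proof -
  have "\<exists>d>0. v = w \<or> (\<forall>x\<in>C v. \<forall>y\<in>C w. d \<le> dist x y)" if vw: "v \<in> I" "w \<in> I" for v w
  proof (cases "v = w")
    case True
    then show ?thesis using zero_less_one by blast
  next
    case False
    show ?thesis
    proof (cases "C v = {} \<or> C w = {}")
      case True
      then show ?thesis using zero_less_one by blast
    next
      case ne: False
      have cl: "closed (C w)" using assms(2)[OF vw(2)] by (rule compact_imp_closed)
      have cont: "continuous_on (C v) (\<lambda>x. infdist x (C w))" by (intro continuous_intros)
      obtain x0 where x0: "x0 \<in> C v" "\<And>x. x \<in> C v \<Longrightarrow> infdist x0 (C w) \<le> infdist x (C w)"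
        using continuous_attains_inf[OF assms(2)[OF vw(1)] _ cont] ne by blast
      have "infdist x0 (C w) \<noteq> 0"
        using in_closed_iff_infdist_zero[OF cl, of x0] ne x0(1) disj[OF vw False] by auto
      then have "infdist x0 (C w) > 0" using infdist_nonneg[of x0 "C w"] by simp
      moreover have "infdist x0 (C w) \<le> dist x y" if "x \<in> C v" "y \<in> C w" for x y
        using x0(2)[OF that(1)] infdist_le[OF that(2), of x] by simp
      ultimately show ?thesis by blast
    qed
  qed
  then obtain d where d: "\<And>v w. v \<in> I \<Longrightarrow> w \<in> I \<Longrightarrow> d v w > 0 \<and> (v = w \<or> (\<forall>x\<in>C v. \<forall>y\<in>C w. d v w \<le> dist x y))"
    by metis
  \<comment> \<open>The element 1 keeps the minimum meaningful when \<open>I\<close> is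
    empty.\<close>
  define S where "S = insert 1 ((\<lambda>(v, w). d v w) ` (I \<times> I))"
  have S: "finite S" "S \<noteq> {}" using assms(1) by (auto simp: S_def)
  have "Min S > 0" using S d by (auto simp: S_def)
  moreover have "v = w" if vw: "v \<in> I" "w \<in> I" "x \<in> C v" "y \<in> C w" "dist x y < Min S" for v w x y
  proof -
    have "d v w \<in> S" using vw by (auto simp: S_def)
    then have "Min S \<le> d v w" using S by simp
    then have "dist x y < d v w" using vw(5) by simp
    then show ?thesis using d[OF vw(1,2)] vw(3,4) by force
  qed
  ultimately show ?thesis by blast
qed

text \<open>Meant for a labeling with one cell of nearly full mass and all others nearly null; every
  term of its entropy is then small.\<close>

lemma mult_ln_small_near_0_1:
  fixes a :: real
  assumes "a > 0"
  shows "\<exists>\<kappa>>0. \<forall>q\<in>{0..1}. q < \<kappa> \<or> 1 - \<kappa> < q \<longrightarrow> - (q * ln q) < a"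
proof -
  have "\<exists>d>0. \<forall>x\<in>{0..1}. \<forall>y\<in>{0..1::real}. dist y x < d \<longrightarrow> dist (y * ln y) (x * ln x) < a"
    using uniformly_continuous_mult_ln assms unfolding uniformly_continuous_on_def by (elim allE impE)
  then obtain d where d: "d > 0"
    "\<forall>x\<in>{0..1}. \<forall>y\<in>{0..1::real}. dist y x < d \<longrightarrow> dist (y * ln y) (x * ln x) < a"
    by (elim exE conjE)
  have "- (q * ln q) < a" if q: "q \<in> {0..1}" "q < d \<or> 1 - d < q" for q
    using q(2)
  proof
    assume "q < d"
    then have "dist (q * ln q) (0 * ln 0) < a" using q(1) by (intro d(2)[rule_format]) (auto simp: dist_real_def)
    then show ?thesis by (simp add: dist_real_def)
  next
    assume "1 - d < q"
    then have "dist (q * ln q) (1 * ln 1) < a" using q(1) by (intro d(2)[rule_format]) (auto simp: dist_real_def)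
    then show ?thesis by (simp add: dist_real_def)
  qed
  then show ?thesis using d(1) by blast
qed

text \<open>\<open>Z\<close> is a finite union of disjoint compact sets filling almost all of the
  cells of \<open>\<eta>\<close>. Their mutual distances are bounded below, so close points of
  \<open>Z\<close> share their label. The labeling \<open>0\<close> on \<open>Z\<close> and
  \<open>Suc (\<eta> x)\<close> elsewhere has one dominant cell, hence small entropy.\<close>

lemma partition_compact_core:
  fixes X :: "'a::metric_space set" and \<eta> :: "'a \<Rightarrow> nat"
  assumes X: "compact X" and M: "borel_prob X M" and e: "simple_function M \<eta>" and a: "a > 0"
  shows "\<exists>Z \<rho>. \<rho> > 0 \<and> (\<forall>x\<in>Z. \<forall>y\<in>Z. dist x y < \<rho> \<longrightarrow> \<eta> x = \<eta> y) \<and>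
    simple_function M (\<lambda>x. if x \<in> Z then 0 else Suc (\<eta> x)) \<and>
    part_entropy M (\<lambda>x. if x \<in> Z then 0 else Suc (\<eta> x)) \<le> a"
proof -
  interpret prob_space M using M by (simp add: borel_prob_def)
  define I where "I = \<eta> ` space M"
  have I: "finite I" using e by (simp add: I_def simple_function_def)
  \<comment> \<open>The number of labels available to the new labeling: one for each value of
    \<open>\<eta>\<close> and the extra label 0.\<close>
  define c where "c = real (card I) + 1"
  have c: "c > 0" by (simp add: c_def)
  obtain \<kappa> where k: "\<kappa> > 0" "\<And>q. q \<in> {0..1} \<Longrightarrow> q < \<kappa> \<or> 1 - \<kappa> < q \<Longrightarrow> - (q * ln q) < a / c"
    using mult_ln_small_near_0_1[of "a / c"] a c by (meson divide_pos_pos)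
  define A where "A v = \<eta> -` {v} \<inter> space M" for v
  have A: "A v \<in> sets M" for v unfolding A_def by (rule simple_functionD(2)[OF e])
  \<comment> \<open>Each cell may lose \<open>\<kappa> / c\<close>. All losses together stay below
    \<open>\<kappa>\<close>, which leaves the label 0 with mass above
    \<open>1 - \<kappa>\<close>.\<close>
  have "\<exists>C. compact C \<and> C \<subseteq> A v \<and> C \<in> sets M \<and> measure M (A v - C) < \<kappa> / c" for v
    using borel_prob_inner_compact[OF X M A] k(1) c by simp
  then obtain C where C: "\<And>v. compact (C v)" "\<And>v. C v \<subseteq> A v" "\<And>v. C v \<in> sets M"
    "\<And>v. measure M (A v - C v) < \<kappa> / c" by metis
  define Z where "Z = (\<Union>v\<in>I. C v)"
  have ZM: "Z \<in> sets M" unfolding Z_def using C(3) I by auto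
  have "C v \<inter> C w = {}" if "v \<noteq> w" for v w using C(2)[of v] C(2)[of w] that by (auto simp: A_def)
  then obtain \<rho> where rho: "\<rho> > 0" "\<forall>v\<in>I. \<forall>w\<in>I. \<forall>x\<in>C v. \<forall>y\<in>C w. dist x y < \<rho> \<longrightarrow> v = w"
    using finite_compact_separation[OF I, of C] C(1) by metis
  have lab: "\<eta> x = v" if "x \<in> C v" for x v using C(2)[of v] that by (auto simp: A_def)
  have core: "\<eta> x = \<eta> y" if xy: "x \<in> Z" "y \<in> Z" "dist x y < \<rho>" for x y
  proof -
    obtain v w where "v \<in> I" "w \<in> I" "x \<in> C v" "y \<in> C w" using xy by (auto simp: Z_def)
    then show ?thesis using rho(2) xy(3) lab by metis
  qed
  let ?b = "\<lambda>x. if x \<in> Z then 0 else Suc (\<eta> x)"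
  have b: "simple_function M ?b"
    by (rule simple_function_If_set[OF simple_function_const simple_function_compose1[OF e]])
      (use ZM in \<open>auto intro: sets.Int\<close>)
  have ZA: "Z \<inter> A v = C v" if "v \<in> I" for v
    using that C(2) lab by (auto simp: Z_def A_def)
  have small: "cell_prob M ?b (Suc v) < \<kappa> / c" if "v \<in> I" for v
  proof -
    have "?b -` {Suc v} \<inter> space M = A v - Z" by (auto simp: A_def split: if_splits)
    also have "\<dots> = A v - C v" using ZA[OF that] by auto
    finally show ?thesis using C(4)[of v] by simp
  qed
  have kc: "\<kappa> / c \<le> \<kappa>" using k(1) by (simp add: c_def field_simps)
  have img: "?b ` space M \<subseteq> insert 0 (Suc ` I)" by (auto simp: I_def)
  have fin: "finite (insert 0 (Suc ` I))" using I by simp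
  have "1 = (\<Sum>v\<in>insert 0 (Suc ` I). cell_prob M ?b v)"
    unfolding cell_prob_sum[OF b, symmetric]
    by (rule sum.mono_neutral_left[OF fin img]) (use cell_prob_eq_0[of _ ?b M] in blast)
  also have "\<dots> = cell_prob M ?b 0 + (\<Sum>v\<in>I. cell_prob M ?b (Suc v))"
    using I by (subst sum.insert) (auto simp: sum.reindex)
  also have "(\<Sum>v\<in>I. cell_prob M ?b (Suc v)) \<le> real (card I) * (\<kappa> / c)"
    by (rule sum_bounded_above) (use small in \<open>auto intro: less_imp_le\<close>)
  also have "\<dots> < \<kappa>" using k(1) by (simp add: c_def field_simps)
  finally have big: "1 - \<kappa> < cell_prob M ?b 0" by simp
  have each: "- (cell_prob M ?b v * ln (cell_prob M ?b v)) \<le> a / c" if v: "v \<in> insert 0 (Suc ` I)" for v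
  proof -
    have "cell_prob M ?b v < \<kappa> \<or> 1 - \<kappa> < cell_prob M ?b v"
      using v big small kc by fastforce
    then show ?thesis using k(2)[of "cell_prob M ?b v"] by (simp add: prob_le_1)
  qed
  have "part_entropy M ?b = (\<Sum>v\<in>insert 0 (Suc ` I). - (cell_prob M ?b v * ln (cell_prob M ?b v)))"
    by (simp only: part_entropy_superset[OF fin img] sum_negf)
  also have "\<dots> \<le> real (card (insert 0 (Suc ` I))) * (a / c)"
    by (rule sum_bounded_above[OF each])
  also have "real (card (insert 0 (Suc ` I))) = c"
    using I by (simp add: c_def card_image)
  finally have le: "part_entropy M ?b \<le> a" using c by simp
  show ?thesis
    by (rule exI[of _ Z], rule exI[of _ \<rho>]) (intro conjI ballI impI rho(1) core b le)
qed

lemma card_image_le_cover: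
  assumes D: "finite D" and cov: "\<And>z. z \<in> S \<Longrightarrow> \<exists>A\<in>D. z \<in> A"
    and eq: "\<And>z z' A. z \<in> S \<Longrightarrow> z' \<in> S \<Longrightarrow> A \<in> D \<Longrightarrow> z \<in> A \<Longrightarrow> z' \<in> A \<Longrightarrow> \<beta> z = \<beta> z'"
  shows "finite (\<beta> ` S)" "card (\<beta> ` S) \<le> card D"
proof -
  have sub: "\<beta> ` S \<subseteq> (\<lambda>A. \<beta> (SOME z. z \<in> A \<inter> S)) ` D"
  proof (rule image_subsetI)
    fix z assume z: "z \<in> S"
    then obtain A where A: "A \<in> D" "z \<in> A" using cov by blast
    have "(SOME z. z \<in> A \<inter> S) \<in> A \<inter> S" by (rule someI[of _ z]) (use z A in simp)
    then have "\<beta> z = \<beta> (SOME z. z \<in> A \<inter> S)" using eq[OF z _ A] by simp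
    then show "\<beta> z \<in> (\<lambda>A. \<beta> (SOME z. z \<in> A \<inter> S)) ` D" using A(1) by (rule image_eqI)
  qed
  show "finite (\<beta> ` S)" using D by (rule finite_surj[OF _ sub])
  show "card (\<beta> ` S) \<le> card D" using D sub by (rule surj_card_le)
qed

text \<open>The joint name under \<open>\<xi>\<close> and under the small-entropy labeling
  \<open>b\<close> almost determines the \<open>\<eta>\<close>-name. Equal
  \<open>\<xi>\<close>-names force \<open>\<epsilon>\<close>-close orbits, which
  \<open>bowen_ball_count\<close> covers by few small sets; within one small set equal
  \<open>b\<close>-names give equal \<open>\<eta>\<close>-names.\<close>

lemma join_part_entropy_le:
  fixes X :: "'a::metric_space set" and \<xi> \<eta> :: "'a \<Rightarrow> nat"
  assumes X: "compact X" and Y: "compact Y" "Y \<subseteq> X" and g: "g \<in> homeos X"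
    and h: "\<forall>y\<in>Y. htop X g (Gamma X \<epsilon> y g) = 0"
    and M: "borel_prob X M" "invariant_measure M g" "AE x in M. x \<in> Y"
    and xi: "simple_function M \<xi>" and diam: "\<forall>x\<in>X. \<forall>y\<in>X. \<xi> x = \<xi> y \<longrightarrow> dist x y \<le> \<epsilon>"
    and eta: "simple_function M \<eta>" and a: "a > 0"
  shows "\<exists>m N. \<forall>n. part_entropy M (join_part g \<eta> n)
           \<le> part_entropy M (join_part g \<xi> (n + (2 * m + 1))) + real n * a + a * real (n + N)"
proof -
  interpret prob_space M using M by (simp add: borel_prob_def)
  have sp: "space M = X" using M(1) by (simp add: borel_prob_def)
  have gC: "g \<in> C0 X" using g homeos_subset_C0 by auto
  obtain Z \<rho> where Z: "\<rho> > 0" "\<forall>x\<in>Z. \<forall>y\<in>Z. dist x y < \<rho> \<longrightarrow> \<eta> x = \<eta> y"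
    "simple_function M (\<lambda>x. if x \<in> Z then 0 else Suc (\<eta> x))"
    "part_entropy M (\<lambda>x. if x \<in> Z then 0 else Suc (\<eta> x)) \<le> a"
    using partition_compact_core[OF X M(1) eta a] by (elim exE conjE) (rule that)
  define b where "b x = (if x \<in> Z then 0 else Suc (\<eta> x))" for x
  have b: "simple_function M b" "part_entropy M b \<le> a" using Z(3,4) by (simp_all add: b_def[abs_def])
  \<comment> \<open>With this choice of \<open>\<delta>\<close> the bound
    \<open>4 * \<delta>\<close> in \<open>bowen_ball_count\<close> becomes the separation
    \<open>\<rho>\<close> of the core.\<close>
  have "\<rho> / 4 > 0" using Z(1) by simp
  from bowen_ball_count[OF X Y g h this a] obtain m N where
    cnt: "\<forall>n x. x \<in> X \<longrightarrow> (\<forall>t. (g ^^ t) x \<in> Y) \<longrightarrow>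
    (\<exists>D. finite D \<and> real (card D) \<le> exp (a * real (n + N)) \<and>
       {z\<in>X. \<forall>j\<le>n + 2 * m. dist ((g ^^ j) z) ((g ^^ j) x) \<le> \<epsilon>} \<subseteq> \<Union>D \<and>
       (\<forall>A\<in>D. \<forall>z\<in>A. \<forall>z'\<in>A. \<forall>j<n. dist ((g ^^ (m + j)) z) ((g ^^ (m + j)) z') < 4 * (\<rho> / 4)))"
    by (elim exE)
  \<comment> \<open>\<open>bowen_ball_count\<close> needs the whole forward orbit in
    \<open>Y\<close>. By invariance this holds almost everywhere, as a countable intersection of
    full-measure conditions.\<close>
  define G where "G = {x. \<forall>t. (g ^^ t) x \<in> Y}"
  have AEG: "AE x in M. x \<in> G"
  proof -
    have "AE x in M. (g ^^ t) x \<in> Y" for t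
    proof (rule AE_distrD[of _ M M])
      show "AE x in distr M M (g ^^ t). x \<in> Y" using M(3) unfolding invariant_measure_funpow(2)[OF M(2)] .
    qed (rule invariant_measure_funpow(1)[OF M(2)])
    then show ?thesis by (simp add: G_def AE_all_countable)
  qed
  have "part_entropy M (join_part g \<eta> n)
           \<le> part_entropy M (join_part g \<xi> (n + (2 * m + 1))) + real n * a + a * real (n + N)" for n
  proof -
    \<comment> \<open>The times from 0 to \<open>n + 2 * m\<close> inclusive must be recorded, which
      explains the 1.\<close>
    let ?s = "n + (2 * m + 1)"
    \<comment> \<open>The small sets control times from \<open>m\<close> on, so the
      \<open>\<eta>\<close>-name is read from time \<open>m\<close>; invariance removes the shift at
      the end.\<close>
    let ?\<beta> = "\<lambda>x. join_part g \<eta> n ((g ^^ m) x)"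
    let ?w = "\<lambda>x. join_part g b n ((g ^^ m) x)"
    let ?\<alpha> = "\<lambda>x. (join_part g \<xi> ?s x, ?w x)"
    note cb = part_entropy_comp_distr[OF invariant_measure_funpow[OF M(2), of m] simple_function_join_part[OF M(2) eta, of n]]
    note cw = part_entropy_comp_distr[OF invariant_measure_funpow[OF M(2), of m] simple_function_join_part[OF M(2) b(1), of n]]
    note sx = simple_function_join_part[OF M(2) xi, of ?s]
    have bnd: "finite (?\<beta> ` {x \<in> space M \<inter> G. ?\<alpha> x = u}) \<and>
        real (card (?\<beta> ` {x \<in> space M \<inter> G. ?\<alpha> x = u})) \<le> exp (a * real (n + N))" for u
    proof (cases "{x \<in> space M \<inter> G. ?\<alpha> x = u} = {}")
      case True
      show ?thesis unfolding True by simp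
    next
      case False
      then obtain x where x: "x \<in> X" "x \<in> G" "?\<alpha> x = u" using sp by blast
      define S where "S = {x \<in> space M \<inter> G. ?\<alpha> x = u}"
      obtain D where D: "finite D" "real (card D) \<le> exp (a * real (n + N))"
         "{z\<in>X. \<forall>j\<le>n + 2 * m. dist ((g ^^ j) z) ((g ^^ j) x) \<le> \<epsilon>} \<subseteq> \<Union>D"
         "\<forall>A\<in>D. \<forall>z\<in>A. \<forall>z'\<in>A. \<forall>j<n. dist ((g ^^ (m + j)) z) ((g ^^ (m + j)) z') < 4 * (\<rho> / 4)"
      proof -
        have "\<forall>t. (g ^^ t) x \<in> Y" using x(2) by (simp add: G_def)
        from cnt[rule_format, OF x(1) this[rule_format], of n] show thesis by (elim exE conjE) (rule that)
      qed
      have cov: "\<exists>A\<in>D. z \<in> A" if z: "z \<in> S" for z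
      proof -
        have zX: "z \<in> X" and eq: "join_part g \<xi> ?s z = join_part g \<xi> ?s x"
          using z x(3) sp by (auto simp: S_def)
        have "dist ((g ^^ j) z) ((g ^^ j) x) \<le> \<epsilon>" if "j \<le> n + 2 * m" for j
          using eq that zX x(1) C0_funpow(2)[OF gC] by (intro diam[rule_format]) (auto simp: join_part_eq_iff)
        then show ?thesis using D(3) zX by blast
      qed
      have uniq: "?\<beta> z = ?\<beta> z'" if z: "z \<in> S" "z' \<in> S" "A \<in> D" "z \<in> A" "z' \<in> A" for z z' A
        unfolding join_part_eq_iff
      proof (intro allI impI)
        fix i assume i: "i < n"
        have "?w z = ?w z'" using z(1,2) by (auto simp: S_def)
        then have weq: "b ((g ^^ i) ((g ^^ m) z)) = b ((g ^^ i) ((g ^^ m) z'))"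
          using i by (simp add: join_part_eq_iff)
        have it: "(g ^^ i) ((g ^^ m) y) = (g ^^ (m + i)) y" for y
          by (metis add.commute comp_apply funpow_add)
        have "dist ((g ^^ (m + i)) z) ((g ^^ (m + i)) z') < \<rho>" using D(4) z(3-5) i by simp
        \<comment> \<open>A common \<open>b\<close>-label 0 puts both points in \<open>Z\<close> at
          distance below \<open>\<rho>\<close>; any other common label already contains the value of
          \<open>\<eta>\<close>.\<close>
        then show "\<eta> ((g ^^ i) ((g ^^ m) z)) = \<eta> ((g ^^ i) ((g ^^ m) z'))"
          using weq Z(2) unfolding it b_def by (auto split: if_splits)
      qed
      have "finite (?\<beta> ` S)" "card (?\<beta> ` S) \<le> card D"
        using card_image_le_cover[OF D(1) cov uniq] by simp_all
      then show ?thesis using D(2) unfolding S_def[symmetric] by linarith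
    qed
    have "part_entropy M ?\<beta> \<le> part_entropy M ?\<alpha> + ln (exp (a * real (n + N)))"
      by (rule part_entropy_le_count[OF simple_function_Pair[OF sx cw(1)] cb(1) AEG])
        (use bnd in auto)
    also have "part_entropy M ?\<alpha> \<le> part_entropy M (join_part g \<xi> ?s) + part_entropy M ?w"
      by (rule part_entropy_pair_le[OF sx cw(1)])
    also have "part_entropy M ?w \<le> real n * a"
      using cw(2) part_entropy_join_le[OF M(2) b(1), of n] mult_left_mono[OF b(2), of "real n"] by simp
    finally show ?thesis using cb(2) by simp
  qed
  then show ?thesis by blast
qed

text \<open>Dividing \<open>join_part_entropy_le\<close> by the length removes the bounded terms:
  the additional \<open>2 * m + 1\<close> letters and the constant
  \<open>a * real N\<close>.\<close>

lemma ks_rate_le_of_h_expansive: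
  fixes X :: "'a::metric_space set" and \<xi> \<eta> :: "'a \<Rightarrow> nat"
  assumes X: "compact X" and Y: "compact Y" "Y \<subseteq> X" and g: "g \<in> homeos X"
    and h: "\<forall>y\<in>Y. htop X g (Gamma X \<epsilon> y g) = 0"
    and M: "borel_prob X M" "invariant_measure M g" "AE x in M. x \<in> Y"
    and xi: "simple_function M \<xi>" and diam: "\<forall>x\<in>X. \<forall>y\<in>X. \<xi> x = \<xi> y \<longrightarrow> dist x y \<le> \<epsilon>"
    and eta: "simple_function M \<eta>"
  shows "ks_rate M g \<eta> \<le> ks_rate M g \<xi>"
proof (rule field_le_epsilon)
  fix e :: real assume e: "e > 0"
  interpret prob_space M using M by (simp add: borel_prob_def)
  \<comment> \<open>Per time step \<open>a\<close> is paid twice, once for the entropy of the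
    auxiliary labeling and once for the counting.\<close>
  define a where "a = e / 2"
  have a: "a > 0" using e by (simp add: a_def)
  obtain m N where mN: "\<And>n. part_entropy M (join_part g \<eta> n)
      \<le> part_entropy M (join_part g \<xi> (n + (2 * m + 1))) + real n * a + a * real (n + N)"
    using join_part_entropy_le[OF X Y g h M xi diam eta a] by blast
  define K where "K = part_entropy M (join_part g \<xi> (2 * m + 1)) + a * real N"
  have le: "part_entropy M (join_part g \<eta> (Suc n)) / real (Suc n)
      \<le> part_entropy M (join_part g \<xi> (Suc n)) / real (Suc n) + e + K / real (Suc n)" for n
  proof -
    have "part_entropy M (join_part g \<eta> (Suc n))
        \<le> part_entropy M (join_part g \<xi> (Suc n)) + e * real (Suc n) + K"
      using mN[of "Suc n"] part_entropy_join_subadd[OF M(2) xi, of "Suc n" "2 * m + 1"]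
      unfolding K_def a_def by (simp add: field_simps)
    then have "part_entropy M (join_part g \<eta> (Suc n)) / real (Suc n)
        \<le> (part_entropy M (join_part g \<xi> (Suc n)) + e * real (Suc n) + K) / real (Suc n)"
      by (rule divide_right_mono) simp
    then show ?thesis by (simp add: add_divide_distrib)
  qed
  have "(\<lambda>n. K / real (Suc n)) \<longlonglongrightarrow> 0"
    using tendsto_mult_right_zero[OF LIMSEQ_inverse_real_of_nat, of K] by (simp only: divide_inverse)
  then have "(\<lambda>n. part_entropy M (join_part g \<xi> (Suc n)) / real (Suc n) + e + K / real (Suc n))
      \<longlonglongrightarrow> ks_rate M g \<xi> + e + 0"
    by (intro tendsto_add ks_rate_tendsto(1)[OF M(2) xi] tendsto_const)
  then show "ks_rate M g \<eta> \<le> ks_rate M g \<xi> + e"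
    using LIMSEQ_le[OF ks_rate_tendsto(1)[OF M(2) eta], of _ "ks_rate M g \<xi> + e"] le by simp
qed

section \<open>Continuity of the partition entropy\<close>

lemma integrable_continuous_on_compact:
  fixes \<phi> :: "'a::metric_space \<Rightarrow> real"
  assumes X: "compact X" and M: "borel_prob X M" and c: "continuous_on X \<phi>"
  shows "integrable M \<phi>"
proof -
  interpret prob_space M using M by (simp add: borel_prob_def)
  have sets: "sets M = sets (restrict_space borel X)" and sp: "space M = X"
    using M by (simp_all add: borel_prob_def)
  have meas: "\<phi> \<in> borel_measurable M"
    using borel_measurable_continuous_on_restrict[OF c] measurable_cong_sets[OF sets refl] by blast
  obtain B where B: "\<And>x. x \<in> X \<Longrightarrow> norm (\<phi> x) \<le> B"
    using compact_imp_bounded[OF compact_continuous_image[OF c X]] by (auto simp: bounded_iff)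
  show ?thesis
    by (rule integrable_const_bound[OF _ meas, of B]) (use B sp in \<open>auto intro!: AE_I2\<close>)
qed

text \<open>Points outside the first \<open>k\<close> balls get the label \<open>k\<close>.\<close>

definition ball_label :: "(nat \<Rightarrow> 'a::metric_space) \<Rightarrow> (nat \<Rightarrow> real) \<Rightarrow> nat \<Rightarrow> 'a \<Rightarrow> nat" where
  "ball_label c r k x = (LEAST i. k \<le> i \<or> dist x (c i) < r i)"

lemma ball_label_le: "ball_label c r k x \<le> k"
  unfolding ball_label_def by (rule Least_le) simp

lemma ball_label_in_ball:
  assumes "i < k" "dist x (c i) < r i"
  shows "ball_label c r k x < k" "dist x (c (ball_label c r k x)) < r (ball_label c r k x)"
proof -
  have le: "ball_label c r k x \<le> i" unfolding ball_label_def by (rule Least_le) (use assms in simp)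
  then show lt: "ball_label c r k x < k" using assms(1) by simp
  have "k \<le> ball_label c r k x \<or> dist x (c (ball_label c r k x)) < r (ball_label c r k x)"
    unfolding ball_label_def by (rule LeastI[of _ k]) simp
  then show "dist x (c (ball_label c r k x)) < r (ball_label c r k x)" using lt by simp
qed

text \<open>The distance to a centre is 1-Lipschitz, so a displacement smaller than the distance to
  every bounding sphere crosses none of them.\<close>

lemma ball_label_eq:
  assumes "\<And>i. i < k \<Longrightarrow> dist x y < \<bar>dist x (c i) - r i\<bar>"
  shows "ball_label c r k x = ball_label c r k y"
proof -
  have "(dist x (c i) < r i) = (dist y (c i) < r i)" if "i < k" for i
    using assms[OF that] dist_triangle[of x "c i" y] dist_triangle[of y "c i" x] dist_commute[of x y]
    by linarith
  then have "(k \<le> i \<or> dist x (c i) < r i) = (k \<le> i \<or> dist y (c i) < r i)" for i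
    by (cases "k \<le> i") auto
  then show ?thesis by (simp add: ball_label_def)
qed

lemma simple_function_ball_label:
  fixes c :: "nat \<Rightarrow> 'a::metric_space"
  assumes M: "borel_prob X M"
  shows "simple_function M (ball_label c r k)"
proof -
  have sets: "sets M = sets (restrict_space borel X)"
    using M by (simp_all add: borel_prob_def)
  have [measurable]: "(\<lambda>x. dist x (c i)) \<in> borel_measurable borel" for i
    by (intro borel_measurable_continuous_onI continuous_intros)
  have "ball_label c r k \<in> measurable borel (count_space UNIV)"
    unfolding ball_label_def[abs_def] by measurable
  then have "ball_label c r k \<in> measurable M (count_space UNIV)"
    using measurable_restrict_space1 measurable_cong_sets[OF sets refl] by blast
  moreover have "finite (ball_label c r k ` space M)"
    by (rule finite_subset[of _ "{..k}"]) (auto intro: ball_label_le)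
  ultimately show ?thesis
    by (simp add: fin_partition_iff_simple[symmetric] fin_partition_def)
qed

text \<open>The law of the distance to \<open>x\<close> has at most countably many atoms, and any
  other radius works.\<close>

lemma null_sphere_radius:
  fixes x :: "'a::metric_space"
  assumes M: "borel_prob X M" and e: "e > 0"
  shows "\<exists>r. 0 < r \<and> r < e \<and> measure M {y\<in>X. dist y x = r} = 0"
proof -
  interpret prob_space M using M by (simp add: borel_prob_def)
  have sets: "sets M = sets (restrict_space borel X)" and sp: "space M = X"
    using M by (simp_all add: borel_prob_def)
  have "(\<lambda>y. dist y x) \<in> borel_measurable borel"
    by (intro borel_measurable_continuous_onI continuous_intros)
  then have m: "(\<lambda>y. dist y x) \<in> borel_measurable M"
    using measurable_restrict_space1 measurable_cong_sets[OF sets refl] by blast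
  interpret D: prob_space "distr M borel (\<lambda>y. dist y x)" by (rule prob_space_distr[OF m])
  have "countable {r. measure (distr M borel (\<lambda>y. dist y x)) {r} \<noteq> 0}" by (rule D.countable_support)
  then have "\<not> {0<..<e} \<subseteq> {r. measure (distr M borel (\<lambda>y. dist y x)) {r} \<noteq> 0}"
    using uncountable_open_interval[of 0 e] e countable_subset by blast
  then obtain r where r: "0 < r" "r < e" "measure (distr M borel (\<lambda>y. dist y x)) {r} = 0" by auto
  have "(\<lambda>y. dist y x) -` {r} \<inter> space M = {y\<in>X. dist y x = r}" using sp by auto
  then show ?thesis using r measure_distr[OF m, of "{r}"] by auto
qed

text \<open>Radii below \<open>e / 2\<close> keep each piece within diameter \<open>e\<close>. The
  balls cover \<open>X\<close>, so no point of \<open>X\<close> receives the leftover label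
  \<open>k\<close>.\<close>

lemma null_boundary_balls:
  fixes X :: "'a::metric_space set"
  assumes X: "compact X" and M: "borel_prob X M" and e: "e > 0"
  shows "\<exists>c r k. (\<forall>i<k. measure M {x\<in>X. dist x (c i) = r i} = 0) \<and>
    (\<forall>x\<in>X. \<forall>y\<in>X. ball_label c r k x = ball_label c r k y \<longrightarrow> dist x y \<le> e)"
proof -
  have "\<forall>x. \<exists>r. 0 < r \<and> r < e / 2 \<and> measure M {y\<in>X. dist y x = r} = 0"
    using null_sphere_radius[OF M, of "e / 2"] e by simp
  then obtain s where s: "\<And>x. 0 < s x" "\<And>x. s x < e / 2" "\<And>x. measure M {y\<in>X. dist y x = s x} = 0"
    by metis
  have "X \<subseteq> (\<Union>x\<in>X. ball x (s x))" using s(1) by force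
  then obtain F where F: "F \<subseteq> X" "finite F" "X \<subseteq> (\<Union>x\<in>F. ball x (s x))"
    using compactE_image[OF X, of X "\<lambda>x. ball x (s x)"] by auto
  obtain l where l: "set l = F" using finite_list[OF F(2)] by blast
  define c where "c i = l ! i" for i
  define r where "r i = s (c i)" for i
  have "dist x y \<le> e" if xy: "x \<in> X" "y \<in> X" "ball_label c r (length l) x = ball_label c r (length l) y" for x y
  proof -
    have lab: "dist z (c (ball_label c r (length l) z)) < e / 2" if z: "z \<in> X" for z
    proof -
      obtain p where p: "p \<in> F" "dist z p < s p" using F(3) z by (force simp: dist_commute)
      then obtain i where i: "i < length l" "l ! i = p" using l by (metis in_set_conv_nth)
      have "dist z (c i) < r i" using i p by (simp add: c_def r_def)
      from ball_label_in_ball(2)[where r = r and c = c and x = z, OF i(1) this] show ?thesis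
        unfolding r_def[of "ball_label c r (length l) z"] using s(2) by (rule order_less_trans)
    qed
    show ?thesis
      using lab[OF xy(1)] lab[OF xy(2)] dist_triangle2[of x y "c (ball_label c r (length l) x)"] xy(3) by simp
  qed
  moreover have "\<forall>i<length l. measure M {x\<in>X. dist x (c i) = r i} = 0" using s(3) by (simp add: r_def)
  ultimately show ?thesis
    by (intro exI[of _ c] exI[of _ r] exI[of _ "length l"]) blast
qed

section \<open>Continuous cutoffs near the bounding spheres\<close>

definition bump :: "real \<Rightarrow> real \<Rightarrow> real" where
  "bump \<theta> h = max 0 (min 1 (2 - \<bar>h\<bar> / \<theta>))"

lemma bump_bounds: "0 \<le> bump \<theta> h" "bump \<theta> h \<le> 1"
  by (auto simp: bump_def)

lemma bump_eq_1: "\<theta> > 0 \<Longrightarrow> \<bar>h\<bar> \<le> \<theta> \<Longrightarrow> bump \<theta> h = 1"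
  by (simp add: bump_def field_simps)

lemma bump_eq_0: "\<theta> > 0 \<Longrightarrow> 2 * \<theta> \<le> \<bar>h\<bar> \<Longrightarrow> bump \<theta> h = 0"
  by (simp add: bump_def field_simps)

lemma continuous_on_bump:
  "\<theta> > 0 \<Longrightarrow> continuous_on S \<phi> \<Longrightarrow> continuous_on S (\<lambda>x. bump \<theta> (\<phi> x))"
  unfolding bump_def by (intro continuous_intros) auto

lemma bump_tendsto_0:
  assumes "h \<noteq> 0"
  shows "(\<lambda>l. bump (1 / real (Suc l)) h) \<longlonglongrightarrow> 0"
proof -
  obtain N where N: "1 / real (Suc N) < \<bar>h\<bar> / 2" using nat_approx_posE[of "\<bar>h\<bar> / 2"] assms by auto
  have "bump (1 / real (Suc l)) h = 0" if "l \<ge> N" for l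
  proof (rule bump_eq_0)
    have "1 / real (Suc l) \<le> 1 / real (Suc N)" using that by (intro frac_le) auto
    then show "2 * (1 / real (Suc l)) \<le> \<bar>h\<bar>" using N by linarith
  qed simp
  then show ?thesis by (intro tendsto_eventually) (auto simp: eventually_sequentially)
qed

text \<open>Bounds from above the indicator of the points whose \<open>n\<close>-orbit comes \<open>\<theta>\<close>-close to one of
the bounding spheres.\<close>

definition sphere_bump ::
  "('a::metric_space \<Rightarrow> 'a) \<Rightarrow> (nat \<Rightarrow> 'a) \<Rightarrow> (nat \<Rightarrow> real) \<Rightarrow> nat \<Rightarrow> nat \<Rightarrow> real \<Rightarrow> 'a \<Rightarrow> real" where
  "sphere_bump f c r k n \<theta> x = (\<Sum>(i, j)\<in>{..<k} \<times> {..<n}. bump \<theta> (dist ((f ^^ j) x) (c i) - r i))"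

lemma sphere_bump_nonneg: "0 \<le> sphere_bump f c r k n \<theta> x"
  unfolding sphere_bump_def by (intro sum_nonneg) (auto simp: bump_bounds)

lemma sphere_bump_ge_1:
  assumes "\<theta> > 0" "i < k" "j < n" "\<bar>dist ((f ^^ j) x) (c i) - r i\<bar> \<le> \<theta>"
  shows "1 \<le> sphere_bump f c r k n \<theta> x"
proof -
  have "(case (i, j) of (i, j) \<Rightarrow> bump \<theta> (dist ((f ^^ j) x) (c i) - r i)) \<le> sphere_bump f c r k n \<theta> x"
    unfolding sphere_bump_def using assms by (intro member_le_sum) (auto simp: bump_bounds)
  then show ?thesis using bump_eq_1[OF assms(1,4)] by simp
qed

lemma continuous_on_sphere_bump:
  assumes f: "f \<in> C0 X" and "\<theta> > 0"
  shows "continuous_on X (sphere_bump f c r k n \<theta>)"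
  unfolding sphere_bump_def[abs_def] case_prod_unfold
  by (intro continuous_on_sum continuous_on_bump assms continuous_intros C0_funpow(1)[OF f])

text \<open>Invariance makes the preimages of the spheres null as well, so the bumps tend to 0
  almost everywhere as \<open>\<theta>\<close> shrinks. Dominated convergence applies with the
  number \<open>k * n\<close> of summands as bound.\<close>

lemma sphere_bump_small_integral:
  fixes X :: "'a::metric_space set"
  assumes X: "compact X" and f: "f \<in> C0 X" and M: "borel_prob X M" "invariant_measure M f"
    and null: "\<forall>i<k. measure M {x\<in>X. dist x (c i) = r i} = 0" and kappa: "\<kappa> > 0"
  shows "\<exists>\<theta>>0. integral\<^sup>L M (sphere_bump f c r k n \<theta>) < \<kappa>"
proof -
  interpret prob_space M using M by (simp add: borel_prob_def)
  have sets: "sets M = sets (restrict_space borel X)" and sp: "space M = X"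
    using M by (simp_all add: borel_prob_def)
  let ?s = "\<lambda>l. sphere_bump f c r k n (1 / real (Suc l))"
  have AE0: "AE x in M. dist ((f ^^ j) x) (c i) \<noteq> r i" if i: "i < k" for i j
  proof (rule AE_distrD[of _ M M])
    have "{x\<in>X. dist x (c i) = r i} = X \<inter> {x. dist x (c i) = r i}" by auto
    moreover have "closed {x. dist x (c i) = r i}" by (intro closed_Collect_eq continuous_intros)
    ultimately have meas: "{x\<in>X. dist x (c i) = r i} \<in> sets M"
      unfolding sets sets_restrict_space by auto
    have "AE x in M. dist x (c i) \<noteq> r i"
      by (rule AE_I[of _ _ "{x\<in>X. dist x (c i) = r i}"])
        (use null i meas sp in \<open>auto simp: emeasure_eq_measure\<close>)
    then show "AE x in distr M M (f ^^ j). dist x (c i) \<noteq> r i"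
      unfolding invariant_measure_funpow(2)[OF M(2)] .
  qed (rule invariant_measure_funpow(1)[OF M(2)])
  have "AE x in M. \<forall>p\<in>{..<k} \<times> {..<n}. dist ((f ^^ snd p) x) (c (fst p)) \<noteq> r (fst p)"
    by (rule AE_finite_allI) (use AE0 in auto)
  then have AElim: "AE x in M. (\<lambda>l. ?s l x) \<longlonglongrightarrow> 0"
  proof eventually_elim
    case (elim x)
    then show ?case unfolding sphere_bump_def case_prod_unfold
      by (intro tendsto_null_sum bump_tendsto_0) auto
  qed
  have "(\<lambda>l. integral\<^sup>L M (?s l)) \<longlonglongrightarrow> integral\<^sup>L M (\<lambda>x. 0)"
  proof (rule integral_dominated_convergence[where w = "\<lambda>x. real (k * n)"])
    show "?s l \<in> borel_measurable M" for l
      using integrable_continuous_on_compact[OF X M(1) continuous_on_sphere_bump[OF f]] by simp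
    show "AE x in M. norm (?s l x) \<le> real (k * n)" for l
    proof (rule AE_I2)
      fix x
      have "?s l x \<le> real (card ({..<k} \<times> {..<n})) * 1"
        unfolding sphere_bump_def by (rule sum_bounded_above) (auto simp: bump_bounds)
      then show "norm (?s l x) \<le> real (k * n)" using sphere_bump_nonneg[of f c r k n _ x] by simp
    qed
  qed (use AElim in auto)
  then have "(\<lambda>l. integral\<^sup>L M (?s l)) \<longlonglongrightarrow> 0" by simp
  then have "\<forall>\<^sub>F l in sequentially. integral\<^sup>L M (?s l) < \<kappa>" using kappa by (rule order_tendstoD)
  then obtain l where "integral\<^sup>L M (?s l) < \<kappa>" by (auto simp: eventually_sequentially)
  then show ?thesis by (intro exI[of _ "1 / real (Suc l)"]) simp
qed

text \<open>Used twice: with \<open>g = f\<close> to see that names are locally constant away from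
  the spheres, and with \<open>g\<close> near \<open>f\<close> to compare the names of one point
  under two maps.\<close>

lemma join_ball_label_eq:
  assumes "\<And>i j. i < k \<Longrightarrow> j < n \<Longrightarrow> dist ((f ^^ j) x) ((g ^^ j) y) < \<bar>dist ((f ^^ j) x) (c i) - r i\<bar>"
  shows "join_part f (ball_label c r k) n x = join_part g (ball_label c r k) n y"
  using assms ball_label_eq[of k _ _ c r] by (simp add: join_part_def)

text \<open>Where the orbit of \<open>x\<close> meets a sphere, \<open>sphere_bump\<close> is at
  least 1 on a neighbourhood and the cutoff factor vanishes. Elsewhere the name, hence the indicator
  of the cell, is locally constant.\<close>

lemma continuous_on_cell_bump:
  fixes X :: "'a::metric_space set"
  assumes f: "f \<in> C0 X" and t: "\<theta> > 0"
  shows "continuous_on X (\<lambda>x. (if join_part f (ball_label c r k) n x = s then 1 else 0)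
           * max 0 (1 - sphere_bump f c r k n \<theta> x))"
    (is "continuous_on X (\<lambda>x. ?\<chi> x * ?m x)")
  unfolding continuous_on_def
proof
  fix x assume x: "x \<in> X"
  let ?F = "at x within X"
  have m: "(?m \<longlongrightarrow> ?m x) ?F"
  proof -
    have "continuous_on X ?m" by (intro continuous_intros continuous_on_sphere_bump f t)
    then show ?thesis using x by (simp add: continuous_on_def)
  qed
  have fj: "((\<lambda>y. (f ^^ j) y) \<longlongrightarrow> (f ^^ j) x) ?F" for j
    using C0_funpow(1)[OF f, of j] x by (simp add: continuous_on_def)
  show "((\<lambda>x. ?\<chi> x * ?m x) \<longlongrightarrow> ?\<chi> x * ?m x) ?F"
  proof (cases "\<exists>i<k. \<exists>j<n. dist ((f ^^ j) x) (c i) = r i")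
    case True
    then obtain i j where ij: "i < k" "j < n" "dist ((f ^^ j) x) (c i) = r i" by blast
    have "((\<lambda>y. \<bar>dist ((f ^^ j) y) (c i) - r i\<bar>) \<longlongrightarrow> \<bar>dist ((f ^^ j) x) (c i) - r i\<bar>) ?F"
      by (intro tendsto_intros fj)
    moreover have "\<bar>dist ((f ^^ j) x) (c i) - r i\<bar> < \<theta>" using ij t by simp
    ultimately have "\<forall>\<^sub>F y in ?F. \<bar>dist ((f ^^ j) y) (c i) - r i\<bar> < \<theta>" by (rule order_tendstoD)
    then have "\<forall>\<^sub>F y in ?F. ?\<chi> y * ?m y = 0"
    proof eventually_elim
      case (elim y)
      then have "1 \<le> sphere_bump f c r k n \<theta> y" by (intro sphere_bump_ge_1[OF t ij(1,2)]) simp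
      then show ?case by simp
    qed
    moreover have "?\<chi> x * ?m x = 0"
      using sphere_bump_ge_1[OF t ij(1,2), of f x c r] ij t by simp
    ultimately show ?thesis by (simp only: tendsto_eventually)
  next
    case False
    have "\<forall>\<^sub>F y in ?F. \<forall>p\<in>{..<k} \<times> {..<n}.
        dist ((f ^^ snd p) x) ((f ^^ snd p) y) < \<bar>dist ((f ^^ snd p) x) (c (fst p)) - r (fst p)\<bar>"
    proof (rule eventually_ball_finite, simp, rule ballI)
      fix p assume p: "p \<in> {..<k} \<times> {..<n}"
      have "((\<lambda>y. dist ((f ^^ snd p) x) ((f ^^ snd p) y)) \<longlongrightarrow> dist ((f ^^ snd p) x) ((f ^^ snd p) x)) ?F"
        by (intro tendsto_intros fj)
      moreover have "dist ((f ^^ snd p) x) ((f ^^ snd p) x) < \<bar>dist ((f ^^ snd p) x) (c (fst p)) - r (fst p)\<bar>"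
        using False p by auto
      ultimately show "\<forall>\<^sub>F y in ?F. dist ((f ^^ snd p) x) ((f ^^ snd p) y)
          < \<bar>dist ((f ^^ snd p) x) (c (fst p)) - r (fst p)\<bar>" by (rule order_tendstoD)
    qed
    then have "\<forall>\<^sub>F y in ?F. ?\<chi> x * ?m y = ?\<chi> y * ?m y"
    proof eventually_elim
      case (elim y)
      then have "join_part f (ball_label c r k) n x = join_part f (ball_label c r k) n y"
        by (intro join_ball_label_eq) auto
      then show ?case by simp
    qed
    then show ?thesis
      by (rule Lim_transform_eventually[OF tendsto_mult[OF tendsto_const m]])
  qed
qed

text \<open>The functions \<open>\<phi> s\<close> approximate the cells of both \<open>f\<close> and
  \<open>g\<close> continuously, with errors bounded by multiples of \<open>\<Psi>\<close>. Weak*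
  closeness transfers the integrals of \<open>\<phi> s\<close> and also the smallness of the
  integral of \<open>\<Psi>\<close> from \<open>M\<close> to \<open>N\<close>.\<close>

lemma cell_prob_close:
  fixes X :: "'a::metric_space set"
  assumes X: "compact X" and f: "f \<in> C0 X" and M: "borel_prob X M" "invariant_measure M f"
    and null: "\<forall>i<k. measure M {x\<in>X. dist x (c i) = r i} = 0" and kappa: "\<kappa> > 0"
  shows "\<exists>\<Phi> \<theta>. finite \<Phi> \<and> (\<forall>\<phi>\<in>\<Phi>. continuous_on X \<phi>) \<and> \<theta> > 0 \<and>
    (\<forall>g N. g \<in> C0 X \<longrightarrow> borel_prob X N \<longrightarrow> invariant_measure N g \<longrightarrow>
       (\<forall>x\<in>X. \<forall>j<n. dist ((f ^^ j) x) ((g ^^ j) x) < \<theta>) \<longrightarrow>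
       (\<forall>\<phi>\<in>\<Phi>. \<bar>integral\<^sup>L N \<phi> - integral\<^sup>L M \<phi>\<bar> < \<kappa>) \<longrightarrow>
       (\<forall>s. \<bar>cell_prob N (join_part g (ball_label c r k) n) s
             - cell_prob M (join_part f (ball_label c r k) n) s\<bar> < 6 * \<kappa>))"
proof -
  let ?\<xi> = "ball_label c r k"
  obtain \<theta> where t: "\<theta> > 0" "integral\<^sup>L M (sphere_bump f c r k n \<theta>) < \<kappa>"
    using sphere_bump_small_integral[OF X f M null kappa] by blast
  define \<Psi> where "\<Psi> = sphere_bump f c r k n \<theta>"
  define \<phi> where "\<phi> s x = (if join_part f ?\<xi> n x = s then 1 else 0) * max 0 (1 - \<Psi> x)" for s x
  define S where "S = {s. set s \<subseteq> {..k} \<and> length s = n}"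
  have S: "finite S" unfolding S_def by (rule finite_lists_length_eq) simp
  have joinS: "join_part h ?\<xi> n x \<in> S" for h x
    by (auto simp: S_def join_part_def intro: ball_label_le)
  have cPsi: "continuous_on X \<Psi>" unfolding \<Psi>_def by (rule continuous_on_sphere_bump[OF f t(1)])
  have cphi: "continuous_on X (\<phi> s)" for s
    unfolding \<phi>_def[abs_def] \<Psi>_def by (rule continuous_on_cell_bump[OF f t(1)])
  have Psi0: "0 \<le> \<Psi> x" for x by (simp add: \<Psi>_def sphere_bump_nonneg)
  have diff: "\<bar>measure N A - integral\<^sup>L N (\<phi> s)\<bar> \<le> b * integral\<^sup>L N \<Psi>"
    if N: "borel_prob X N" and A: "A \<in> sets N" and le: "\<And>x. x \<in> X \<Longrightarrow> \<bar>indicator A x - \<phi> s x\<bar> \<le> b * \<Psi> x"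
    for N A s b
  proof -
    interpret N: prob_space N using N by (simp add: borel_prob_def)
    have sp: "space N = X" using N by (simp add: borel_prob_def)
    note i = integrable_continuous_on_compact[OF X N]
    have iA: "integrable N (indicator A :: 'a \<Rightarrow> real)" using A by (simp add: N.emeasure_eq_measure)
    have "measure N A - integral\<^sup>L N (\<phi> s) = (\<integral>x. indicator A x - \<phi> s x \<partial>N)"
      using iA i[OF cphi] A by (subst Bochner_Integration.integral_diff) auto
    also have "\<bar>\<dots>\<bar> \<le> (\<integral>x. \<bar>indicator A x - \<phi> s x\<bar> \<partial>N)"
      using integral_norm_bound[of N "\<lambda>x. indicator A x - \<phi> s x"] by simp
    also have "\<dots> \<le> (\<integral>x. b * \<Psi> x \<partial>N)"
      by (rule integral_mono)
        (use le sp iA i[OF cphi] i[OF cPsi] in \<open>auto intro!: integrable_abs Bochner_Integration.integrable_diff\<close>)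
    also have "\<dots> = b * integral\<^sup>L N \<Psi>" by simp
    finally show ?thesis .
  qed
  define \<Phi> where "\<Phi> = insert \<Psi> (\<phi> ` S)"
  have fin: "finite \<Phi>" and cont: "\<forall>\<phi>\<in>\<Phi>. continuous_on X \<phi>" using S cPsi cphi by (auto simp: \<Phi>_def)
  have main: "\<bar>cell_prob N (join_part g ?\<xi> n) s - cell_prob M (join_part f ?\<xi> n) s\<bar> < 6 * \<kappa>"
    if g: "g \<in> C0 X" and N: "borel_prob X N" "invariant_measure N g"
      and near: "\<forall>x\<in>X. \<forall>j<n. dist ((f ^^ j) x) ((g ^^ j) x) < \<theta>"
      and ints: "\<forall>\<phi>\<in>\<Phi>. \<bar>integral\<^sup>L N \<phi> - integral\<^sup>L M \<phi>\<bar> < \<kappa>" for g N s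
  proof (cases "s \<in> S")
    case False
    then have "s \<notin> join_part g ?\<xi> n ` space N" "s \<notin> join_part f ?\<xi> n ` space M"
      using joinS by blast+
    then show ?thesis using kappa by (simp add: cell_prob_eq_0)
  next
    case True
    define A where "A = join_part f ?\<xi> n -` {s} \<inter> space M"
    define B where "B = join_part g ?\<xi> n -` {s} \<inter> space N"
    have sp: "space M = X" "space N = X" using M(1) N(1) by (auto simp: borel_prob_def)
    have "prob_space M" "prob_space N" using M(1) N(1) by (auto simp: borel_prob_def)
    then have AB: "A \<in> sets M" "B \<in> sets N"
      unfolding A_def B_def
      using prob_space.simple_function_join_part[OF _ M(2) simple_function_ball_label[OF M(1)]]
        prob_space.simple_function_join_part[OF _ N(2) simple_function_ball_label[OF N(1)]]
      by (auto intro: simple_functionD(2))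
    have dA: "\<bar>indicator A x - \<phi> s x\<bar> \<le> 1 * \<Psi> x" if "x \<in> X" for x
      using that Psi0[of x] sp by (auto simp: A_def \<phi>_def indicator_def max_def)
    have dB: "\<bar>indicator B x - \<phi> s x\<bar> \<le> 2 * \<Psi> x" if x: "x \<in> X" for x
    \<comment> \<open>If \<open>\<Psi> x < 1\<close>, the orbit stays more than
      \<open>\<theta>\<close> away from every sphere and the names under \<open>f\<close> and
      \<open>g\<close> agree. Otherwise \<open>\<phi> s x = 0\<close> and \<open>\<Psi> x\<close>
      alone bounds the indicator.\<close>
    proof (cases "\<Psi> x < 1")
      case True
      have "join_part f ?\<xi> n x = join_part g ?\<xi> n x"
      proof (rule join_ball_label_eq)
        fix i j assume ij: "i < k" "j < n"
        have "\<theta> < \<bar>dist ((f ^^ j) x) (c i) - r i\<bar>"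
          using sphere_bump_ge_1[OF t(1) ij, of f x c r] True unfolding \<Psi>_def by linarith
        then show "dist ((f ^^ j) x) ((g ^^ j) x) < \<bar>dist ((f ^^ j) x) (c i) - r i\<bar>"
          using near x ij(2) by (meson order_less_trans)
      qed
      then have "indicator B x = (indicator A x :: real)" using x sp by (simp add: A_def B_def indicator_def)
      then show ?thesis using dA[OF x] Psi0[of x] by simp
    next
      case False
      then show ?thesis by (auto simp: \<phi>_def indicator_def)
    qed
    have "\<bar>measure M A - integral\<^sup>L M (\<phi> s)\<bar> \<le> 1 * integral\<^sup>L M \<Psi>" by (rule diff[OF M(1) AB(1) dA])
    moreover have "\<bar>measure N B - integral\<^sup>L N (\<phi> s)\<bar> \<le> 2 * integral\<^sup>L N \<Psi>" by (rule diff[OF N(1) AB(2) dB])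
    moreover have "\<bar>integral\<^sup>L N (\<phi> s) - integral\<^sup>L M (\<phi> s)\<bar> < \<kappa>" "\<bar>integral\<^sup>L N \<Psi> - integral\<^sup>L M \<Psi>\<bar> < \<kappa>"
      using ints True by (auto simp: \<Phi>_def)
    moreover have "integral\<^sup>L M \<Psi> < \<kappa>" using t(2) by (simp add: \<Psi>_def)
    \<comment> \<open>The integral of \<open>\<Psi>\<close> over \<open>N\<close> is below
      \<open>2 * \<kappa>\<close>, so the errors are \<open>4 * \<kappa>\<close> on the side of
      \<open>N\<close>, \<open>\<kappa>\<close> for changing the measure and \<open>\<kappa>\<close>
      on the side of \<open>M\<close>.\<close>
    ultimately have "\<bar>measure N B - measure M A\<bar> < 6 * \<kappa>" by linarith
    then show ?thesis by (simp add: A_def B_def)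
  qed
  show ?thesis
    by (rule exI[of _ \<Phi>], rule exI[of _ \<theta>]) (intro conjI fin cont t(1) allI impI main)
qed

text \<open>Over a fixed finite label set the entropy is a finite sum of values of one uniformly
  continuous function, so \<open>\<kappa>\<close> depends only on \<open>T\<close> and
  \<open>e\<close>.\<close>

lemma part_entropy_close:
  fixes T :: "'b set"
  assumes T: "finite T" and e: "e > 0"
  shows "\<exists>\<kappa>>0. \<forall>M N \<alpha> \<beta>. prob_space M \<longrightarrow> prob_space N \<longrightarrow> \<alpha> ` space M \<subseteq> T \<longrightarrow> \<beta> ` space N \<subseteq> T \<longrightarrow>
    (\<forall>s\<in>T. \<bar>cell_prob N \<beta> s - cell_prob M \<alpha> s\<bar> < \<kappa>) \<longrightarrow>
    part_entropy (N :: 'c measure) \<beta> \<le> part_entropy (M :: 'd measure) \<alpha> + e"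
proof -
  define b where "b = e / (real (card T) + 1)"
  have b: "b > 0" using e by (simp add: b_def)
  have "\<exists>d>0. \<forall>x\<in>{0..1}. \<forall>y\<in>{0..1::real}. dist y x < d \<longrightarrow> dist (y * ln y) (x * ln x) < b"
    using uniformly_continuous_mult_ln b unfolding uniformly_continuous_on_def by (elim allE impE)
  then obtain d where d: "d > 0"
    "\<forall>x\<in>{0..1}. \<forall>y\<in>{0..1::real}. dist y x < d \<longrightarrow> dist (y * ln y) (x * ln x) < b"
    by (elim exE conjE)
  have "part_entropy N \<beta> \<le> part_entropy M \<alpha> + e"
    if M: "prob_space M" and N: "prob_space N" and im: "\<alpha> ` space M \<subseteq> T" "\<beta> ` space N \<subseteq> T"
      and cl: "\<forall>s\<in>T. \<bar>cell_prob N \<beta> s - cell_prob M \<alpha> s\<bar> < d"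
    for M :: "'d measure" and N :: "'c measure" and \<alpha> \<beta>
  proof -
    let ?h = "\<lambda>p::real. p * ln p"
    have "?h (cell_prob M \<alpha> s) - ?h (cell_prob N \<beta> s) \<le> b" if s: "s \<in> T" for s
    proof -
      have "dist (?h (cell_prob N \<beta> s)) (?h (cell_prob M \<alpha> s)) < b"
        using cl s prob_space.prob_le_1[OF M] prob_space.prob_le_1[OF N]
        by (intro d(2)[rule_format]) (auto simp: dist_real_def)
      then show ?thesis by (simp add: dist_real_def)
    qed
    then have "(\<Sum>s\<in>T. ?h (cell_prob M \<alpha> s) - ?h (cell_prob N \<beta> s)) \<le> real (card T) * b"
      by (rule sum_bounded_above)
    also have "\<dots> \<le> e" using e by (simp add: b_def field_simps)
    finally show ?thesis
      using part_entropy_superset[OF T im(1)] part_entropy_superset[OF T im(2)] by (simp add: sum_subtractf)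
  qed
  then show ?thesis using d(1) by (intro exI[of _ d]) simp
qed

section \<open>Closeness of iterates and basic open sets of the two topologies\<close>

lemma funpow_close:
  fixes X :: "'a::metric_space set"
  assumes X: "compact X" and f: "f \<in> C0 X" and t: "\<theta> > 0"
  shows "\<exists>\<delta>>0. \<forall>g\<in>C0 X. (\<forall>x\<in>X. dist (f x) (g x) < \<delta>) \<longrightarrow> (\<forall>x\<in>X. dist ((f ^^ j) x) ((g ^^ j) x) < \<theta>)"
  using t
proof (induction j arbitrary: \<theta>)
  case 0
  then show ?case by (intro exI[of _ 1]) simp
next
  case (Suc j)
  have "uniformly_continuous_on X f"
    using f X by (intro compact_uniformly_continuous) (auto simp: C0_def)
  \<comment> \<open>One half is spent on moving the argument of \<open>f\<close>, the other on
    replacing \<open>f\<close> by \<open>g\<close> at the last step.\<close>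
  moreover have "\<theta> / 2 > 0" using Suc.prems by simp
  ultimately have "\<exists>\<sigma>>0. \<forall>x\<in>X. \<forall>y\<in>X. dist y x < \<sigma> \<longrightarrow> dist (f y) (f x) < \<theta> / 2"
    unfolding uniformly_continuous_on_def by (elim allE impE)
  then obtain \<sigma> where s: "\<sigma> > 0" "\<forall>x\<in>X. \<forall>y\<in>X. dist y x < \<sigma> \<longrightarrow> dist (f y) (f x) < \<theta> / 2"
    by (elim exE conjE)
  from Suc.IH[OF s(1)] obtain \<delta> where d: "\<delta> > 0"
    "\<forall>g\<in>C0 X. (\<forall>x\<in>X. dist (f x) (g x) < \<delta>) \<longrightarrow> (\<forall>x\<in>X. dist ((f ^^ j) x) ((g ^^ j) x) < \<sigma>)" by blast
  have "dist ((f ^^ Suc j) x) ((g ^^ Suc j) x) < \<theta>"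
    if g: "g \<in> C0 X" and cl: "\<forall>x\<in>X. dist (f x) (g x) < min \<delta> (\<theta> / 2)" and x: "x \<in> X" for g x
  proof -
    have fx: "(f ^^ j) x \<in> X" and gx: "(g ^^ j) x \<in> X" using C0_funpow(2)[OF f x] C0_funpow(2)[OF g x] by auto
    have "dist ((f ^^ j) x) ((g ^^ j) x) < \<sigma>" using d(2) g cl x by auto
    then have "dist (f ((f ^^ j) x)) (f ((g ^^ j) x)) < \<theta> / 2" using s(2) fx gx by blast
    moreover have "dist (f ((g ^^ j) x)) (g ((g ^^ j) x)) < \<theta> / 2" using cl gx by auto
    ultimately show ?thesis
      using dist_triangle[of "f ((f ^^ j) x)" "g ((g ^^ j) x)" "f ((g ^^ j) x)"] by simp
  qed
  then show ?case using d(1) Suc.prems by (intro exI[of _ "min \<delta> (\<theta> / 2)"]) auto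
qed

lemma funpows_close:
  fixes X :: "'a::metric_space set"
  assumes X: "compact X" and f: "f \<in> C0 X" and t: "\<theta> > 0"
  shows "\<exists>\<delta>>0. \<forall>g\<in>C0 X. (\<forall>x\<in>X. dist (f x) (g x) < \<delta>) \<longrightarrow>
    (\<forall>x\<in>X. \<forall>j<n. dist ((f ^^ j) x) ((g ^^ j) x) < \<theta>)"
proof (induction n)
  case 0
  then show ?case by (intro exI[of _ 1]) simp
next
  case (Suc n)
  then obtain \<delta>1 where d1: "\<delta>1 > 0" "\<forall>g\<in>C0 X. (\<forall>x\<in>X. dist (f x) (g x) < \<delta>1) \<longrightarrow>
    (\<forall>x\<in>X. \<forall>j<n. dist ((f ^^ j) x) ((g ^^ j) x) < \<theta>)" by (elim exE conjE)
  obtain \<delta>2 where d2: "\<delta>2 > 0" "\<forall>g\<in>C0 X. (\<forall>x\<in>X. dist (f x) (g x) < \<delta>2) \<longrightarrow>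
    (\<forall>x\<in>X. dist ((f ^^ n) x) ((g ^^ n) x) < \<theta>)" using funpow_close[OF X f t, of n] by (elim exE conjE)
  have "\<forall>g\<in>C0 X. (\<forall>x\<in>X. dist (f x) (g x) < min \<delta>1 \<delta>2) \<longrightarrow>
    (\<forall>x\<in>X. \<forall>j<Suc n. dist ((f ^^ j) x) ((g ^^ j) x) < \<theta>)"
    using d1(2) d2(2) by (simp add: less_Suc_eq)
  then show ?case using d1(1) d2(1) by (intro exI[of _ "min \<delta>1 \<delta>2"]) simp
qed

lemma unif_dist_props:
  fixes X :: "'a::metric_space set"
  assumes X: "compact X" "X \<noteq> {}" and f: "f \<in> C0 X" and g: "g \<in> C0 X"
  shows "x \<in> X \<Longrightarrow> dist (f x) (g x) \<le> unif_dist X f g"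
    and "unif_dist X f f = 0"
    and "h \<in> C0 X \<Longrightarrow> unif_dist X f h \<le> unif_dist X f g + unif_dist X g h"
proof -
  have up: "dist (u x) (v x) \<le> unif_dist X u v" if "u \<in> C0 X" "v \<in> C0 X" "x \<in> X" for u v x
    unfolding unif_dist_def
  proof (rule cSUP_upper[OF that(3)])
    have "continuous_on X (\<lambda>x. dist (u x) (v x))" using that by (intro continuous_intros) (auto simp: C0_def)
    then show "bdd_above ((\<lambda>x. dist (u x) (v x)) ` X)"
      by (intro bounded_imp_bdd_above compact_imp_bounded compact_continuous_image X(1))
  qed
  show "x \<in> X \<Longrightarrow> dist (f x) (g x) \<le> unif_dist X f g" by (rule up[OF f g])
  show "unif_dist X f f = 0" using X(2) by (simp add: unif_dist_def)
  show "unif_dist X f h \<le> unif_dist X f g + unif_dist X g h" if h: "h \<in> C0 X"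
    unfolding unif_dist_def[of X f h]
  proof (rule cSUP_least[OF X(2)])
    fix x assume x: "x \<in> X"
    show "dist (f x) (h x) \<le> unif_dist X f g + unif_dist X g h"
      using up[OF f g x] up[OF g h x] dist_triangle[of "f x" "h x" "g x"] by linarith
  qed
qed

lemma unif_open_ball:
  fixes X :: "'a::metric_space set"
  assumes X: "compact X" "X \<noteq> {}" and f: "f \<in> C0 X"
  shows "unif_open X {g \<in> C0 X. unif_dist X f g < \<delta>}"
proof -
  have "\<exists>d>0. \<forall>g\<in>C0 X. unif_dist X h g < d \<longrightarrow> g \<in> {g \<in> C0 X. unif_dist X f g < \<delta>}"
    if h: "h \<in> C0 X" "unif_dist X f h < \<delta>" for h
    using unif_dist_props(3)[OF X f h(1)] h(2) by (intro exI[of _ "\<delta> - unif_dist X f h"]) fastforce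
  then show ?thesis unfolding unif_open_def by simp
qed

lemma weak_star_open_nbhd:
  assumes fin: "finite \<Phi>" and cont: "\<forall>\<phi>\<in>\<Phi>. continuous_on Y \<phi>" and k: "\<kappa> > 0"
  shows "weak_star_open X Y {\<nu> \<in> PY X Y. \<forall>\<phi>\<in>\<Phi>. \<bar>intY Y \<nu> \<phi> - intY Y \<mu> \<phi>\<bar> < \<kappa>}" (is "weak_star_open X Y ?U")
  unfolding weak_star_open_def
proof (intro conjI ballI)
  show "?U \<subseteq> PY X Y" by auto
  fix \<mu>' assume m: "\<mu>' \<in> ?U"
  \<comment> \<open>The least remaining slack among the finitely many strict inequalities;
    \<open>\<kappa>\<close> is inserted to cover an empty \<open>\<Phi>\<close>.\<close>
  define \<eta> where "\<eta> = Min (insert \<kappa> ((\<lambda>\<phi>. \<kappa> - \<bar>intY Y \<mu>' \<phi> - intY Y \<mu> \<phi>\<bar>) ` \<Phi>))"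
  have pos: "\<eta> > 0" unfolding \<eta>_def using fin m k by (subst Min_gr_iff) auto
  have le: "\<eta> \<le> \<kappa> - \<bar>intY Y \<mu>' \<phi> - intY Y \<mu> \<phi>\<bar>" if "\<phi> \<in> \<Phi>" for \<phi>
    unfolding \<eta>_def using fin that by (intro Min_le) auto
  have "{\<nu>\<in>PY X Y. \<forall>\<phi>\<in>\<Phi>. \<bar>intY Y \<nu> \<phi> - intY Y \<mu>' \<phi>\<bar> < \<eta>} \<subseteq> ?U"
    using le by fastforce
  then show "\<exists>\<Phi> \<eta>. finite \<Phi> \<and> (\<forall>\<phi>\<in>\<Phi>. continuous_on Y \<phi>) \<and> \<eta> > 0 \<and>
      {\<nu>\<in>PY X Y. \<forall>\<phi>\<in>\<Phi>. \<bar>intY Y \<nu> \<phi> - intY Y \<mu>' \<phi>\<bar> < \<eta>} \<subseteq> ?U"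
    using fin cont pos by (intro exI[of _ \<Phi>] exI[of _ \<eta>] conjI)
qed

section \<open>Choice of the neighbourhoods and the final estimate\<close>

theorem mainTheorem14:
  fixes X Y :: "'a::metric_space set" and \<U> :: "('a \<Rightarrow> 'a) set"
    and f :: "'a \<Rightarrow> 'a" and \<mu> :: "'a measure" and \<epsilon> :: real
  assumes "compact X" and "finite_covering_dim X"
    and "compact Y" and "Y \<subseteq> X"
    and "\<U> \<subseteq> C0 X" and "\<U> \<subseteq> homeos X"
    and "unif_h_expansive X \<U> Y"
    and "f \<in> \<U>"
    and "borel_prob X \<mu>" and "invariant_measure \<mu> f" and "msupp X \<mu> \<subseteq> Y"
    and "\<epsilon> > 0"
  shows "\<exists>\<V> U. unif_open X \<V> \<and> f \<in> \<V> \<and> weak_star_open X Y U \<and> \<mu> \<in> U \<and>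
           (\<forall>g\<in>\<U> \<inter> \<V>. \<forall>\<nu>\<in>U. invariant_measure \<nu> g \<longrightarrow>
              metric_entropy \<nu> g \<le> metric_entropy \<mu> f + ereal \<epsilon>)"
proof -
  note X = assms(1) and Y = assms(3,4) and mu = assms(9,10)
  have f: "f \<in> C0 X" using assms(5,8) by blast
  interpret \<mu>: prob_space \<mu> using mu(1) by (simp add: borel_prob_def)
  \<comment> \<open>A probability lives on \<open>X\<close>, so the supremum in
    \<open>unif_dist\<close> runs over a nonempty set.\<close>
  have ne: "X \<noteq> {}" using \<mu>.not_empty mu(1) by (simp add: borel_prob_def)
  \<comment> \<open>The constant is common to all of \<open>\<U>\<close>, so the one partition
    \<open>\<xi>\<close>, adapted to \<open>\<mu>\<close>, bounds the entropy of every
    \<open>g\<close> under consideration.\<close>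
  obtain \<epsilon>0 where e0: "\<epsilon>0 > 0" "\<forall>g\<in>\<U>. \<forall>y\<in>Y. htop X g (Gamma X \<epsilon>0 y g) = 0"
    using assms(7) unfolding unif_h_expansive_def by (elim exE conjE)
  obtain c r k where null: "\<forall>i<k. measure \<mu> {x\<in>X. dist x (c i) = r i} = 0"
    and diam: "\<forall>x\<in>X. \<forall>y\<in>X. ball_label c r k x = ball_label c r k y \<longrightarrow> dist x y \<le> \<epsilon>0"
    using null_boundary_balls[OF X mu(1) e0(1)] by (elim exE conjE)
  define \<xi> where "\<xi> = ball_label c r k"
  have xi: "simple_function M \<xi>" if "borel_prob X M" for M
    unfolding \<xi>_def by (rule simple_function_ball_label[OF that])
  have "\<forall>\<^sub>F n in sequentially. part_entropy \<mu> (join_part f \<xi> (Suc n)) / real (Suc n) < ks_rate \<mu> f \<xi> + \<epsilon> / 2"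
    using \<mu>.ks_rate_tendsto(1)[OF mu(2) xi[OF mu(1)]] by (rule order_tendstoD) (use assms(12) in simp)
  \<comment> \<open>This length is fixed from here on. It costs \<open>\<epsilon> / 2\<close>; the
    other half is left for the change from \<open>f\<close>, \<open>\<mu>\<close> to
    \<open>g\<close>, \<open>\<nu>\<close>.\<close>
  then obtain n where n: "part_entropy \<mu> (join_part f \<xi> (Suc n)) / real (Suc n) < ks_rate \<mu> f \<xi> + \<epsilon> / 2"
    by (auto simp: eventually_sequentially)
  define S where "S = {s. set s \<subseteq> {..k} \<and> length s = Suc n}"
  have S: "finite S" unfolding S_def by (rule finite_lists_length_eq) simp
  have joinS: "join_part h \<xi> (Suc n) ` A \<subseteq> S" for h and A :: "'a set"
    by (auto simp: S_def join_part_def \<xi>_def intro: ball_label_le)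
  \<comment> \<open>The tolerance is scaled by the length because the entropies are divided by
    \<open>Suc n\<close> later.\<close>
  have "real (Suc n) * (\<epsilon> / 2) > 0" using assms(12) by simp
  from part_entropy_close[OF S this, where ?'c = 'a and ?'d = 'a] obtain \<kappa> where kappa: "\<kappa> > 0"
    and ent: "\<forall>M N \<alpha> \<beta>. prob_space M \<longrightarrow> prob_space N \<longrightarrow> \<alpha> ` space M \<subseteq> S \<longrightarrow> \<beta> ` space N \<subseteq> S \<longrightarrow>
      (\<forall>s\<in>S. \<bar>cell_prob N \<beta> s - cell_prob M \<alpha> s\<bar> < \<kappa>) \<longrightarrow>
      part_entropy (N :: 'a measure) \<beta> \<le> part_entropy (M :: 'a measure) \<alpha> + real (Suc n) * (\<epsilon> / 2)"
    by (elim exE conjE)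
  \<comment> \<open>Compensates the factor 6 in \<open>cell_prob_close\<close>.\<close>
  have k6: "\<kappa> / 6 > 0" using kappa by simp
  obtain \<Phi> \<theta> where Phi: "finite \<Phi>" "\<forall>\<phi>\<in>\<Phi>. continuous_on X \<phi>" and theta: "\<theta> > 0"
    and close: "\<forall>g N. g \<in> C0 X \<longrightarrow> borel_prob X N \<longrightarrow> invariant_measure N g \<longrightarrow>
       (\<forall>x\<in>X. \<forall>j<Suc n. dist ((f ^^ j) x) ((g ^^ j) x) < \<theta>) \<longrightarrow>
       (\<forall>\<phi>\<in>\<Phi>. \<bar>integral\<^sup>L N \<phi> - integral\<^sup>L \<mu> \<phi>\<bar> < \<kappa> / 6) \<longrightarrow>
       (\<forall>s. \<bar>cell_prob N (join_part g \<xi> (Suc n)) s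
             - cell_prob \<mu> (join_part f \<xi> (Suc n)) s\<bar> < 6 * (\<kappa> / 6))"
    using cell_prob_close[OF X f mu null k6, of "Suc n"] unfolding \<xi>_def by (elim exE conjE)
  obtain \<delta> where delta: "\<delta> > 0" "\<forall>g\<in>C0 X. (\<forall>x\<in>X. dist (f x) (g x) < \<delta>) \<longrightarrow>
      (\<forall>x\<in>X. \<forall>j<Suc n. dist ((f ^^ j) x) ((g ^^ j) x) < \<theta>)"
    using funpows_close[OF X f theta, of "Suc n"] by (elim exE conjE)
  define \<V> where "\<V> = {g \<in> C0 X. unif_dist X f g < \<delta>}"
  define U where "U = {\<nu> \<in> PY X Y. \<forall>\<phi>\<in>\<Phi>. \<bar>intY Y \<nu> \<phi> - intY Y \<mu> \<phi>\<bar> < \<kappa> / 6}"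
  have inY: "AE x in \<nu>. x \<in> Y" if "\<nu> \<in> PY X Y" for \<nu>
    using that msupp_null[OF X _ compact_imp_closed[OF Y(1)]] by (auto simp: PY_def)
  have muPY: "\<mu> \<in> PY X Y" using mu(1) assms(11) by (simp add: PY_def)
  \<comment> \<open>The weak* topology integrates over \<open>Y\<close>, while the estimates above
    integrate over \<open>X\<close>. The two agree because the measures in \<open>PY X Y\<close> are
    carried by \<open>Y\<close>.\<close>
  have int: "intY Y \<nu> \<phi> = integral\<^sup>L \<nu> \<phi>" if nu: "\<nu> \<in> PY X Y" and phi: "\<phi> \<in> \<Phi>" for \<nu> \<phi>
  proof -
    have b: "borel_prob X \<nu>" using nu by (simp add: PY_def)
    have i: "integrable \<nu> \<phi>" using integrable_continuous_on_compact[OF X b] Phi(2) phi by blast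
    have sets: "sets \<nu> = sets (restrict_space borel X)" using b by (simp add: borel_prob_def)
    have "Y = X \<inter> Y" using Y(2) by blast
    then have Ym: "Y \<in> sets \<nu>"
      unfolding sets sets_restrict_space using borel_closed[OF compact_imp_closed[OF Y(1)]] by blast
    show ?thesis unfolding intY_def
    proof (rule integral_cong_AE)
      show "(\<lambda>x. indicator Y x * \<phi> x) \<in> borel_measurable \<nu>"
        using i Ym by (intro borel_measurable_times borel_measurable_indicator) auto
      show "AE x in \<nu>. indicator Y x * \<phi> x = \<phi> x" using inY[OF nu] by eventually_elim simp
    qed (use i in auto)
  qed
  have "metric_entropy \<nu> g \<le> metric_entropy \<mu> f + ereal \<epsilon>"
    if g: "g \<in> \<U> \<inter> \<V>" and nu: "\<nu> \<in> U" and inv: "invariant_measure \<nu> g" for g \<nu>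
  proof -
    have nuP: "\<nu> \<in> PY X Y" and b: "borel_prob X \<nu>" using nu by (auto simp: U_def PY_def)
    interpret \<nu>: prob_space \<nu> using b by (simp add: borel_prob_def)
    have gC: "g \<in> C0 X" and gh: "g \<in> homeos X" and gd: "unif_dist X f g < \<delta>"
      and gU: "\<forall>y\<in>Y. htop X g (Gamma X \<epsilon>0 y g) = 0"
      using g assms(6) e0(2) by (auto simp: \<V>_def)
    have "dist (f x) (g x) < \<delta>" if "x \<in> X" for x
      using unif_dist_props(1)[OF X ne f gC that] gd by simp
    then have near: "\<forall>x\<in>X. \<forall>j<Suc n. dist ((f ^^ j) x) ((g ^^ j) x) < \<theta>" using delta(2) gC by simp
    have "\<forall>\<phi>\<in>\<Phi>. \<bar>integral\<^sup>L \<nu> \<phi> - integral\<^sup>L \<mu> \<phi>\<bar> < \<kappa> / 6"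
      using nu int[OF nuP] int[OF muPY] by (simp add: U_def)
    from close[rule_format, OF gC b inv near[rule_format] this[rule_format]]
    have "\<forall>s\<in>S. \<bar>cell_prob \<nu> (join_part g \<xi> (Suc n)) s - cell_prob \<mu> (join_part f \<xi> (Suc n)) s\<bar> < \<kappa>"
      by simp
    with ent[rule_format, OF \<mu>.prob_space_axioms \<nu>.prob_space_axioms joinS joinS]
    have "part_entropy \<nu> (join_part g \<xi> (Suc n)) \<le> part_entropy \<mu> (join_part f \<xi> (Suc n)) + real (Suc n) * (\<epsilon> / 2)"
      by blast
    then have "part_entropy \<nu> (join_part g \<xi> (Suc n)) / real (Suc n)
        \<le> (part_entropy \<mu> (join_part f \<xi> (Suc n)) + real (Suc n) * (\<epsilon> / 2)) / real (Suc n)"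
      by (rule divide_right_mono) simp
    also have "\<dots> = part_entropy \<mu> (join_part f \<xi> (Suc n)) / real (Suc n) + \<epsilon> / 2"
      unfolding add_divide_distrib by (subst nonzero_mult_div_cancel_left) auto
    finally have "part_entropy \<nu> (join_part g \<xi> (Suc n)) / real (Suc n) \<le> ks_rate \<mu> f \<xi> + \<epsilon>"
      using n by linarith
    \<comment> \<open>The rate of \<open>\<nu>\<close> is an infimum over lengths, so the estimate
      at the single length \<open>Suc n\<close> suffices.\<close>
    then have ks: "ks_rate \<nu> g \<xi> \<le> ks_rate \<mu> f \<xi> + \<epsilon>"
      using \<nu>.ks_rate_tendsto(2)[OF inv xi[OF b], of n] by linarith
    have mu_ge: "ereal (ks_rate \<mu> f \<xi>) \<le> metric_entropy \<mu> f"
      unfolding metric_entropy_def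
      by (rule SUP_upper) (use xi[OF mu(1)] in \<open>simp add: fin_partition_iff_simple\<close>)
    show ?thesis
      unfolding metric_entropy_def[of \<nu> g]
    proof (rule SUP_least)
      fix \<eta> assume "\<eta> \<in> {\<xi>. fin_partition \<nu> \<xi>}"
      then have "simple_function \<nu> \<eta>" by (simp add: fin_partition_iff_simple)
      \<comment> \<open>h-expansivity of \<open>g\<close> at scale \<open>\<epsilon>0\<close> lets
        \<open>\<xi>\<close> dominate an arbitrary partition \<open>\<eta>\<close> for
        \<open>\<nu>\<close>.\<close>
      from ks_rate_le_of_h_expansive[OF X Y gh gU b inv inY[OF nuP] xi[OF b] diam[folded \<xi>_def] this] ks
      have "ereal (ks_rate \<nu> g \<eta>) \<le> ereal (ks_rate \<mu> f \<xi>) + ereal \<epsilon>" by simp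
      also have "\<dots> \<le> metric_entropy \<mu> f + ereal \<epsilon>" by (rule add_right_mono[OF mu_ge])
      finally show "ereal (ks_rate \<nu> g \<eta>) \<le> metric_entropy \<mu> f + ereal \<epsilon>" .
    qed
  qed
  moreover have "unif_open X \<V>" unfolding \<V>_def by (rule unif_open_ball[OF X ne f])
  moreover have "f \<in> \<V>" using f delta(1) unif_dist_props(2)[OF X ne f f] by (simp add: \<V>_def)
  moreover have "weak_star_open X Y U" unfolding U_def
    by (rule weak_star_open_nbhd[OF Phi(1) _ k6]) (use Phi(2) Y(2) continuous_on_subset in blast)
  moreover have "\<mu> \<in> U" using muPY k6 by (simp add: U_def)
  ultimately show ?thesis by blast
qed

end
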